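(* Let $K$ be a field, let $E$ be a graph, and let $H$ be a hereditary saturated subset of $E^0$. The following are equivalent: (1) The ideal $I(H)$ of $L(E)$ is prime. (2) $M=E^0\setminus H$ is a maximal tail.
   Context: A (directed) graph $E=(E^0,E^1,r,s)$ consists of countable sets $E^0$ (vertices) and $E^1$ (edges) and maps $r,s:E^1\to E^0$ (range and source). All graphs are assumed row-finite: $s^{-1}(v)$ is finite for every $v\in E^0$. A path is a sequence of edges $\mu=(\mu_1,\dots,\mu_n)$ with $r(\mu_i)=s(\mu_{i+1})$; $s(\mu)=s(\mu_1)$, $r(\mu)=r(\mu_n)$; vertices are paths of length $0$. Write $v\ge w$ if there is a path $\mu$ (possibly of length $0$) with $s(\mu)=v$, $r(\mu)=w$. A subset $H\subseteq E^0$ is hereditary if $v\in H$ and $v\ge w$ imply $w\in H$; it is saturated if $s^{-1}(v)\ne\emptyset$ and $r(s^{-1}(v))\subseteq H$ imply $v\in H$. A nonempty subset $M\subseteq E^0$ is a maximal tail if: (MT1) if $v\in E^0$, $w\in M$ and $v\ge w$, then $v\in M$; (MT2) if $v\in M$ with $s^{-1}(v)\neq\emptyset$, then there is $e\in E^1$ with $s(e)=v$ and $r(e)\in M$; (MT3) for every $v,w\in M$ there is $y\in M$ with $v\ge y$ and $w\ge y$. The Leavitt path algebra $L(E)=L_K(E)$ is the (not necessarily unital) $K$-algebra generated by a set $\{v: v\in E^0\}$ of pairwise orthogonal idempotents together with variables $\{e,e^*: e\in E^1\}$ subject to: $s(e)e=er(e)=e$; $r(e)e^*=e^*s(e)=e^*$;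 $e^*e'=\delta_{e,e'}r(e)$ for $e,e'\in E^1$; $v=\sum_{s(e)=v}ee^*$ for every $v\in E^0$ that emits edges. For $H\subseteq E^0$, $I(H)$ is the two-sided ideal of $L(E)$ generated by $H$. A proper two-sided ideal $I$ of a ring $R$ is prime if for all two-sided ideals $J,J'$ of $R$ with $JJ'\subseteq I$, either $J\subseteq I$ or $J'\subseteq I$. *)

theory Defs
  imports
    "HOL-Library.Countable_Set"
    "HOL-Algebra.QuotRing"
    "HOL-Algebra.Ideal_Product"
    "HOL-Algebra.Module"
    "Graph_Theory.Arc_Walk"
begin

text \<open>The source and range maps are \<^const>\<open>tail\<close> and \<^const>\<open>head\<close>, and
  \<^term>\<open>out_arcs G v\<close> is the set of edges emitted by \<open>v\<close>.\<close>

locale row_finite_graph = wf_digraph +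
  assumes countable_verts: "countable (verts G)"
    and countable_arcs: "countable (arcs G)"
    and row_finite: "v \<in> verts G \<Longrightarrow> finite (out_arcs G v)"

definition connects :: "('v, 'e) pre_digraph \<Rightarrow> 'v \<Rightarrow> 'v \<Rightarrow> bool" where
  "connects G v w \<longleftrightarrow> (\<exists>p. pre_digraph.awalk G v p w)"

definition hereditary :: "('v, 'e) pre_digraph \<Rightarrow> 'v set \<Rightarrow> bool" where
  "hereditary G H \<longleftrightarrow> H \<subseteq> verts G \<and> (\<forall>v w. v \<in> H \<and> connects G v w \<longrightarrow> w \<in> H)"

definition saturated :: "('v, 'e) pre_digraph \<Rightarrow> 'v set \<Rightarrow> bool" where
  "saturated G H \<longleftrightarrow> H \<subseteq> verts G \<and>
     (\<forall>v\<in>verts G. out_arcs G v \<noteq> {} \<and> head G ` out_arcs G v \<subseteq> H \<longrightarrow> v \<in> H)"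

definition maximal_tail :: "('v, 'e) pre_digraph \<Rightarrow> 'v set \<Rightarrow> bool" where
  "maximal_tail G M \<longleftrightarrow> M \<subseteq> verts G \<and> M \<noteq> {} \<and>
     (\<forall>v\<in>verts G. \<forall>w\<in>M. connects G v w \<longrightarrow> v \<in> M) \<and>
     (\<forall>v\<in>M. out_arcs G v \<noteq> {} \<longrightarrow> (\<exists>e\<in>out_arcs G v. head G e \<in> M)) \<and>
     (\<forall>v\<in>M. \<forall>w\<in>M. \<exists>y\<in>M. connects G v y \<and> connects G w y)"

text \<open>The locale \<^locale>\<open>ideal\<close> and the constant \<^const>\<open>genideal\<close> presuppose a unital ring,
  and a Leavitt path algebra has a unit only if the graph has finitely many vertices.
  The following notions therefore never refer to the \<open>one\<close> field of the record.\<close>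

definition two_sided_ideal :: "('a, 'm) ring_scheme \<Rightarrow> 'a set \<Rightarrow> bool" where
  "two_sided_ideal R I \<longleftrightarrow> additive_subgroup I R \<and>
     (\<forall>a\<in>I. \<forall>x\<in>carrier R. x \<otimes>\<^bsub>R\<^esub> a \<in> I \<and> a \<otimes>\<^bsub>R\<^esub> x \<in> I)"

definition generated_ideal :: "('a, 'm) ring_scheme \<Rightarrow> 'a set \<Rightarrow> 'a set" where
  "generated_ideal R S = \<Inter>{I. two_sided_ideal R I \<and> S \<subseteq> I}"

definition prime_ideal :: "('a, 'm) ring_scheme \<Rightarrow> 'a set \<Rightarrow> bool" where
  "prime_ideal R I \<longleftrightarrow> two_sided_ideal R I \<and> I \<noteq> carrier R \<and>
     (\<forall>J J'. two_sided_ideal R J \<and> two_sided_ideal R J' \<and> ideal_prod R J J' \<subseteq> I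
        \<longrightarrow> J \<subseteq> I \<or> J' \<subseteq> I)"

text \<open>In an algebra without unit, ring ideals need not be closed under scalars; quotients of
  algebras are taken by ideals that are.\<close>

definition algebra_ideal :: "('k, 'a, 'm) module_scheme \<Rightarrow> 'a set \<Rightarrow> bool" where
  "algebra_ideal A I \<longleftrightarrow> two_sided_ideal A I \<and> (\<forall>c. \<forall>a\<in>I. c \<odot>\<^bsub>A\<^esub> a \<in> I)"

definition generated_algebra_ideal :: "('k, 'a, 'm) module_scheme \<Rightarrow> 'a set \<Rightarrow> 'a set" where
  "generated_algebra_ideal A S = \<Inter>{I. algebra_ideal A I \<and> S \<subseteq> I}"

definition quotient_algebra ::
    "('k, 'a, 'm) module_scheme \<Rightarrow> 'a set \<Rightarrow> ('k, 'a set) module" where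
  "quotient_algebra A I =
     \<lparr>carrier = carrier (A Quot I), monoid.mult = monoid.mult (A Quot I), one = one (A Quot I),
      zero = zero (A Quot I), add = add (A Quot I),
      smult = (\<lambda>c X. \<Union>a\<in>X. I +>\<^bsub>A\<^esub> (c \<odot>\<^bsub>A\<^esub> a))\<rparr>"

datatype ('v, 'e) generator = Vertex 'v | Edge 'e | Ghost 'e

definition generators :: "('v, 'e) pre_digraph \<Rightarrow> ('v, 'e) generator set" where
  "generators G = Vertex ` verts G \<union> Edge ` arcs G \<union> Ghost ` arcs G"

text \<open>The free non-unital algebra on a set \<open>X\<close>: finitely supported functions on the nonempty
  words over \<open>X\<close>, multiplied by convolution along concatenation. It has no unit, so the
  \<open>one\<close> field is left unspecified.\<close>

definition free_algebra :: "'k::field itself \<Rightarrow> 'x set \<Rightarrow> ('k, 'x list \<Rightarrow> 'k) module" where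
  "free_algebra K X =
     \<lparr>carrier = {f. finite {w. f w \<noteq> 0} \<and> (\<forall>w. f w \<noteq> 0 \<longrightarrow> w \<noteq> [] \<and> set w \<subseteq> X)},
      monoid.mult = (\<lambda>f g w. \<Sum>i\<le>length w. f (take i w) * g (drop i w)),
      one = undefined,
      zero = (\<lambda>w. 0),
      add = (\<lambda>f g w. f w + g w),
      smult = (\<lambda>c f w. c * f w)\<rparr>"

definition monomial :: "'x list \<Rightarrow> 'x list \<Rightarrow> 'k::field" where
  "monomial u = (\<lambda>w. if w = u then 1 else 0)"

text \<open>A pair \<open>(a, b)\<close> stands for the defining relation \<open>a = b\<close>.\<close>

inductive_set leavitt_relations ::
    "('v, 'e) pre_digraph \<Rightarrow>
     ((('v, 'e) generator list \<Rightarrow> 'k::field) \<times> (('v, 'e) generator list \<Rightarrow> 'k)) set"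
  for G :: "('v, 'e) pre_digraph" where
    vertex_idem: "v \<in> verts G \<Longrightarrow>
      (monomial [Vertex v, Vertex v], monomial [Vertex v]) \<in> leavitt_relations G"
  | vertex_orth: "\<lbrakk>v \<in> verts G; w \<in> verts G; v \<noteq> w\<rbrakk> \<Longrightarrow>
      (monomial [Vertex v, Vertex w], \<lambda>_. 0) \<in> leavitt_relations G"
  | source_edge: "e \<in> arcs G \<Longrightarrow>
      (monomial [Vertex (tail G e), Edge e], monomial [Edge e]) \<in> leavitt_relations G"
  | edge_range: "e \<in> arcs G \<Longrightarrow>
      (monomial [Edge e, Vertex (head G e)], monomial [Edge e]) \<in> leavitt_relations G"
  | range_ghost: "e \<in> arcs G \<Longrightarrow>
      (monomial [Vertex (head G e), Ghost e], monomial [Ghost e]) \<in> leavitt_relations G"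
  | ghost_source: "e \<in> arcs G \<Longrightarrow>
      (monomial [Ghost e, Vertex (tail G e)], monomial [Ghost e]) \<in> leavitt_relations G"
  | ghost_edge_same: "e \<in> arcs G \<Longrightarrow>
      (monomial [Ghost e, Edge e], monomial [Vertex (head G e)]) \<in> leavitt_relations G"
  | ghost_edge_diff: "\<lbrakk>e \<in> arcs G; e' \<in> arcs G; e \<noteq> e'\<rbrakk> \<Longrightarrow>
      (monomial [Ghost e, Edge e'], \<lambda>_. 0) \<in> leavitt_relations G"
  | vertex_sum: "\<lbrakk>v \<in> verts G; out_arcs G v \<noteq> {}\<rbrakk> \<Longrightarrow>
      (monomial [Vertex v], \<lambda>w. \<Sum>e\<in>out_arcs G v. monomial [Edge e, Ghost e] w)
        \<in> leavitt_relations G"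

definition leavitt_relators ::
    "'k::field itself \<Rightarrow> ('v, 'e) pre_digraph \<Rightarrow> (('v, 'e) generator list \<Rightarrow> 'k) set" where
  "leavitt_relators K G = {(\<lambda>w. a w - b w) | a b. (a, b) \<in> leavitt_relations G}"

definition leavitt_ideal ::
    "'k::field itself \<Rightarrow> ('v, 'e) pre_digraph \<Rightarrow> (('v, 'e) generator list \<Rightarrow> 'k) set" where
  "leavitt_ideal K G =
     generated_algebra_ideal (free_algebra K (generators G)) (leavitt_relators K G)"

definition leavitt_path_algebra ::
    "'k::field itself \<Rightarrow> ('v, 'e) pre_digraph \<Rightarrow>
     ('k, (('v, 'e) generator list \<Rightarrow> 'k) set) module" where
  "leavitt_path_algebra K G =
     quotient_algebra (free_algebra K (generators G)) (leavitt_ideal K G)"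

definition leavitt_vertex ::
    "'k::field itself \<Rightarrow> ('v, 'e) pre_digraph \<Rightarrow> 'v \<Rightarrow> (('v, 'e) generator list \<Rightarrow> 'k) set" where
  "leavitt_vertex K G v =
     leavitt_ideal K G +>\<^bsub>free_algebra K (generators G)\<^esub> monomial [Vertex v]"

definition vertex_ideal ::
    "'k::field itself \<Rightarrow> ('v, 'e) pre_digraph \<Rightarrow> 'v set \<Rightarrow>
     (('v, 'e) generator list \<Rightarrow> 'k) set set" where
  "vertex_ideal K G H = generated_ideal (leavitt_path_algebra K G) (leavitt_vertex K G ` H)"

end

theory Submission
  imports Defs "HOL-Library.Function_Algebras"
begin

text \<open>Let \<open>M\<close> be the set of vertices outside \<open>H\<close>. Two facts about \<open>I(H)\<close> carry the proof, and both
  are proved in the free algebra on the generators, where \<open>I(H)\<close> corresponds to the ideal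
  \<open>vertex_preideal\<close> generated by the Leavitt relators and the vertices of \<open>H\<close>; the correspondence
  of ideals under a surjection (\<open>prime_ideal_image_iff\<close>, \<open>generated_ideal_image\<close>) moves the question
  there once and for all.

  The first fact is that ghosts can be removed. A word multiplied on the right by a long enough path
  is either zero or a path (\<open>word_times_path\<close>), because every ghost of the word meets an edge and
  \<open>e\<^sup>* f\<close> is \<open>r(e)\<close> or \<open>0\<close>. The relation \<open>v = (\<Sum>s(e)=v. e e\<^sup>*)\<close> shows that an element outside an
  ideal stays outside it after multiplication by a suitable path that is as long as one likes or ends
  in a sink (\<open>extend_path\<close>). So an ideal that is not contained in \<open>I(H)\<close> contains a
  nonzero combination \<open>y\<close> of paths, all ending at one vertex of \<open>M\<close>
  (\<open>ideal_contains_ghost_free_element\<close>).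

  The second fact is that \<open>I(H)\<close> annihilates a concrete representation in which the vertices of \<open>M\<close>
  survive. Its points are triples of a vertex of \<open>M\<close>, an integer and a natural number. Each generator
  acts on the points as a partial injection, an edge raises the integer by one and a ghost lowers
  it by one. The integer records the grading of the Leavitt path algebra; without
  it, \<open>v - e\<close> could act as zero where a loop \<open>e\<close> is the only edge that leaves \<open>v\<close>.

  If \<open>M\<close> is a maximal tail and two ideals are not contained in \<open>I(H)\<close>, choose \<open>y\<close> and \<open>y'\<close> in them as
  above, ending at \<open>u\<close> and \<open>u'\<close>, and paths \<open>p\<close> and \<open>p'\<close> from \<open>u\<close> and \<open>u'\<close> to a common vertex
  of \<open>M\<close>. Let \<open>\<alpha>\<close> and \<open>\<alpha>'\<close> be shortest paths occurring in \<open>y\<close> and \<open>y'\<close>. In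
  \<open>\<alpha>\<^sup>* y p p'\<^sup>* \<alpha>'\<^sup>* y'\<close> the only words that have minimal degree and do not act as zero come from \<open>\<alpha>\<close>
  and \<open>\<alpha>'\<close>, so some matrix coefficient is the product of their two nonzero coefficients and the
  product of the ideals is not inside \<open>I(H)\<close> (\<open>product_not_mem\<close>).

  Conversely, if \<open>I(H)\<close> is prime and \<open>v\<close>, \<open>w\<close> are in \<open>M\<close>, then \<open>v g w\<close> is outside \<open>I(H)\<close> for
  some word \<open>g\<close>; after multiplication by a long path \<open>\<mu>\<close> this becomes a path from \<open>v\<close> that ends
  where \<open>\<mu>\<close> ends, and \<open>\<mu>\<close> starts at \<open>w\<close>. The common endpoint is the vertex required of a maximal tail
  (\<open>common_successor\<close>). The remaining conditions on \<open>M\<close> restate that \<open>H\<close> is hereditary, saturated and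
  proper.\<close>

section \<open>Ideals under surjective homomorphisms of rings without unit\<close>

text \<open>The rings need not have a unit, which \<^locale>\<open>ring_hom_ring\<close> presupposes; the structure kept
  from it is that of the additive groups.\<close>

locale rng_epimorphism = abelian_group_hom R S h
  for R (structure) and S (structure) and h +
  assumes hom_mult: "\<lbrakk>x \<in> carrier R; y \<in> carrier R\<rbrakk> \<Longrightarrow> h (x \<otimes>\<^bsub>R\<^esub> y) = h x \<otimes>\<^bsub>S\<^esub> h y"
    and mult_closed: "\<lbrakk>x \<in> carrier R; y \<in> carrier R\<rbrakk> \<Longrightarrow> x \<otimes>\<^bsub>R\<^esub> y \<in> carrier R"
    and surj: "h ` carrier R = carrier S"
begin

definition preimage :: "'c set \<Rightarrow> 'a set" where
  "preimage J = {a \<in> carrier R. h a \<in> J}"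

lemma two_sided_ideal_preimage:
  assumes "two_sided_ideal S J"
  shows "two_sided_ideal R (preimage J)"
proof -
  interpret J: additive_subgroup J S
    using assms by (simp add: two_sided_ideal_def)
  have "subgroup (preimage J) (add_monoid R)"
    by (rule G.add.subgroupI)
      (auto simp: preimage_def intro!: exI[of _ "\<zero>\<^bsub>R\<^esub>"] simp flip: a_inv_def)
  then show ?thesis
    using assms mult_closed
    by (auto simp: two_sided_ideal_def additive_subgroup_def preimage_def hom_mult)
qed

lemma two_sided_ideal_image:
  assumes "two_sided_ideal R I"
  shows "two_sided_ideal S (h ` I)"
proof -
  have "subgroup I (add_monoid R)" and IR: "I \<subseteq> carrier R"
    using assms additive_subgroup.a_subset
    by (auto simp: two_sided_ideal_def additive_subgroup_def)
  then have "subgroup (h ` I) (add_monoid S)"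
    using group_hom.subgroup_img_is_subgroup[OF a_group_hom] by blast
  moreover have "y \<otimes>\<^bsub>S\<^esub> h a \<in> h ` I \<and> h a \<otimes>\<^bsub>S\<^esub> y \<in> h ` I" if a: "a \<in> I" and y: "y \<in> carrier S" for a y
  proof -
    obtain x where x: "x \<in> carrier R" "y = h x" using surj y by blast
    moreover have "x \<otimes>\<^bsub>R\<^esub> a \<in> I" "a \<otimes>\<^bsub>R\<^esub> x \<in> I"
      using assms a x by (auto simp: two_sided_ideal_def)
    ultimately show ?thesis
      using a IR by (metis hom_mult imageI subsetD)
  qed
  ultimately show ?thesis
    by (auto simp: two_sided_ideal_def additive_subgroup_def)
qed

lemma image_preimage:
  assumes "two_sided_ideal S J"
  shows "h ` preimage J = J"
proof -
  have "J \<subseteq> carrier S"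
    using assms additive_subgroup.a_subset by (auto simp: two_sided_ideal_def)
  show ?thesis
  proof
    show "h ` preimage J \<subseteq> J" by (auto simp: preimage_def)
    show "J \<subseteq> h ` preimage J"
    proof
      fix y assume y: "y \<in> J"
      then obtain x where "x \<in> carrier R" "y = h x"
        using surj \<open>J \<subseteq> carrier S\<close> by (metis imageE subsetD)
      then show "y \<in> h ` preimage J" using y by (simp add: preimage_def)
    qed
  qed
qed

lemma in_kernel_iff: "x \<in> a_kernel R S h \<longleftrightarrow> x \<in> carrier R \<and> h x = \<zero>\<^bsub>S\<^esub>"
  unfolding a_kernel_def' by (rule mem_Collect_eq)

lemma kernel_subset_preimage:
  assumes "two_sided_ideal S J"
  shows "a_kernel R S h \<subseteq> preimage J"
proof -
  have "\<zero>\<^bsub>S\<^esub> \<in> J"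
    using assms by (simp add: two_sided_ideal_def additive_subgroup.zero_closed)
  then show ?thesis by (auto simp: in_kernel_iff preimage_def)
qed

lemma preimage_image:
  assumes "two_sided_ideal R I" "a_kernel R S h \<subseteq> I"
  shows "preimage (h ` I) = I"
proof -
  interpret I: additive_subgroup I R
    using assms by (simp add: two_sided_ideal_def)
  have "x \<in> I" if x: "x \<in> carrier R" and y: "y \<in> I" and eq: "h x = h y" for x y
  proof -
    have yR: "y \<in> carrier R" using y by simp
    have "x \<ominus>\<^bsub>R\<^esub> y \<in> a_kernel R S h"
      using x yR eq by (simp add: in_kernel_iff a_minus_def H.r_neg)
    then have "(x \<ominus>\<^bsub>R\<^esub> y) \<oplus>\<^bsub>R\<^esub> y \<in> I" using assms y by auto
    also have "(x \<ominus>\<^bsub>R\<^esub> y) \<oplus>\<^bsub>R\<^esub> y = x"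
      using x yR by (simp add: a_minus_def G.a_assoc G.l_neg)
    finally show ?thesis .
  qed
  then show ?thesis by (auto simp: preimage_def)
qed

lemma two_sided_ideal_Inter:
  assumes "\<And>I. I \<in> C \<Longrightarrow> two_sided_ideal R I" "C \<noteq> {}"
  shows "two_sided_ideal R (\<Inter>C)"
proof -
  have "subgroup (\<Inter>C) (add_monoid R)"
    using assms by (intro G.add.subgroups_Inter)
      (auto simp: two_sided_ideal_def additive_subgroup_def)
  then show ?thesis
    using assms by (auto simp: two_sided_ideal_def additive_subgroup_def)
qed

text \<open>Images of ideals containing the kernel are ideals, and preimages of ideals contain the kernel;
  so the two smallest ideals correspond to each other.\<close>

lemma generated_ideal_image:
  assumes "X \<subseteq> carrier R"
  shows "generated_ideal S (h ` X) = h ` generated_ideal R (a_kernel R S h \<union> X)"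
    (is "?l = h ` ?r")
proof
  have car: "two_sided_ideal R (carrier R)"
    using G.add.subgroup_self mult_closed by (auto simp: two_sided_ideal_def additive_subgroup_def)
  have r: "two_sided_ideal R ?r"
    unfolding generated_ideal_def
    by (rule two_sided_ideal_Inter) (use car assms in \<open>auto simp: in_kernel_iff\<close>)
  have "X \<subseteq> ?r" by (auto simp: generated_ideal_def)
  then show "?l \<subseteq> h ` ?r"
    using two_sided_ideal_image[OF r] unfolding generated_ideal_def[of S] by blast
  show "h ` ?r \<subseteq> ?l"
    unfolding generated_ideal_def[of S]
  proof (rule Inter_greatest)
    fix J assume "J \<in> {I. two_sided_ideal S I \<and> h ` X \<subseteq> I}"
    then have J: "two_sided_ideal S J" "h ` X \<subseteq> J" by auto
    have "?r \<subseteq> preimage J"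
      unfolding generated_ideal_def[of R]
      using two_sided_ideal_preimage[OF J(1)] kernel_subset_preimage[OF J(1)] J(2) assms
      by (intro Inter_lower) (auto simp: preimage_def)
    then show "h ` ?r \<subseteq> J" using image_preimage[OF J(1)] by blast
  qed
qed

lemma ideal_prod_subset_iff:
  assumes "two_sided_ideal S I"
  shows "ideal_prod S J J' \<subseteq> I \<longleftrightarrow> (\<forall>x\<in>J. \<forall>y\<in>J'. x \<otimes>\<^bsub>S\<^esub> y \<in> I)"
proof -
  interpret I: additive_subgroup I S
    using assms by (simp add: two_sided_ideal_def)
  have "z \<in> I" if "\<forall>x\<in>J. \<forall>y\<in>J'. x \<otimes>\<^bsub>S\<^esub> y \<in> I" "z \<in> ideal_prod S J J'" for z
    using that(2) by induction (use that(1) in auto)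
  then show ?thesis by (auto intro: ideal_prod.prod)
qed

text \<open>Ideals of \<open>S\<close> are the images of the ideals of \<open>R\<close> that contain the kernel, so primeness can be
  tested on those. Products of ideals reduce to products of elements, as \<open>I\<close> is closed under sums.\<close>

lemma prime_ideal_image_iff:
  assumes I: "two_sided_ideal R I" and kerI: "a_kernel R S h \<subseteq> I"
  shows "prime_ideal S (h ` I) \<longleftrightarrow> I \<noteq> carrier R \<and>
     (\<forall>A B. two_sided_ideal R A \<and> two_sided_ideal R B \<and>
        a_kernel R S h \<subseteq> A \<and> a_kernel R S h \<subseteq> B \<and> (\<forall>a\<in>A. \<forall>b\<in>B. a \<otimes>\<^bsub>R\<^esub> b \<in> I)
        \<longrightarrow> A \<subseteq> I \<or> B \<subseteq> I)" (is "_ \<longleftrightarrow> _ \<and> ?P")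
proof -
  have hI: "two_sided_ideal S (h ` I)" by (rule two_sided_ideal_image[OF I])
  have IR: "I \<subseteq> carrier R" 
    using I additive_subgroup.a_subset by (auto simp: two_sided_ideal_def)
  have in_I: "h a \<in> h ` I \<longleftrightarrow> a \<in> I" if "a \<in> carrier R" for a
    using preimage_image[OF I kerI] that by (auto simp: preimage_def)
  have proper: "h ` I \<noteq> carrier S \<longleftrightarrow> I \<noteq> carrier R"
    using in_I IR surj by blast
  let ?Q = "\<forall>J J'. two_sided_ideal S J \<and> two_sided_ideal S J' \<and> ideal_prod S J J' \<subseteq> h ` I
        \<longrightarrow> J \<subseteq> h ` I \<or> J' \<subseteq> h ` I"
  have "?Q \<longleftrightarrow> ?P"
  proof
    assume Q: ?Q
    show ?P
    proof (intro allI impI, elim conjE)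
      fix A B assume A: "two_sided_ideal R A" and B: "two_sided_ideal R B"
        and ker: "a_kernel R S h \<subseteq> A" "a_kernel R S h \<subseteq> B"
        and prod: "\<forall>a\<in>A. \<forall>b\<in>B. a \<otimes>\<^bsub>R\<^esub> b \<in> I"
      have AR: "A \<subseteq> carrier R" "B \<subseteq> carrier R"
        using A B additive_subgroup.a_subset by (auto simp: two_sided_ideal_def)
      have "ideal_prod S (h ` A) (h ` B) \<subseteq> h ` I"
        unfolding ideal_prod_subset_iff[OF hI]
      proof (intro ballI)
        fix x y assume "x \<in> h ` A" "y \<in> h ` B"
        then obtain a b where ab: "a \<in> A" "x = h a" "b \<in> B" "y = h b" by blast
        then have "h (a \<otimes>\<^bsub>R\<^esub> b) \<in> h ` I" using prod by blast
        then show "x \<otimes>\<^bsub>S\<^esub> y \<in> h ` I" using ab AR hom_mult[of a b] by (simp add: subset_iff)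
      qed
      then have "h ` A \<subseteq> h ` I \<or> h ` B \<subseteq> h ` I"
        using Q two_sided_ideal_image A B by blast
      then show "A \<subseteq> I \<or> B \<subseteq> I"
        using in_I AR by blast
    qed
  next
    assume P: ?P
    show ?Q
    proof (intro allI impI, elim conjE)
      fix J J' assume J: "two_sided_ideal S J" "two_sided_ideal S J'"
        and prod: "ideal_prod S J J' \<subseteq> h ` I"
      have "\<forall>a\<in>preimage J. \<forall>b\<in>preimage J'. a \<otimes>\<^bsub>R\<^esub> b \<in> I"
      proof (intro ballI)
        fix a b assume "a \<in> preimage J" "b \<in> preimage J'"
        then have ab: "a \<in> carrier R" "b \<in> carrier R" "h a \<in> J" "h b \<in> J'"
          by (auto simp: preimage_def)
        then have "h (a \<otimes>\<^bsub>R\<^esub> b) \<in> h ` I"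
          using prod[unfolded ideal_prod_subset_iff[OF hI]] by (simp add: hom_mult)
        then show "a \<otimes>\<^bsub>R\<^esub> b \<in> I"
          using in_I[OF mult_closed[OF ab(1,2)]] by simp
      qed
      then have "preimage J \<subseteq> I \<or> preimage J' \<subseteq> I"
        using P J two_sided_ideal_preimage kernel_subset_preimage by blast
      then show "J \<subseteq> h ` I \<or> J' \<subseteq> h ` I"
        using image_preimage J by blast
    qed
  qed
  then show ?thesis
    using hI proper by (simp add: prime_ideal_def)
qed

end

section \<open>The free algebra\<close>

text \<open>Functions on words carry the pointwise addition of \<^theory>\<open>HOL-Library.Function_Algebras\<close>; the
  product of the free algebra is written \<open>\<star>\<close>, as \<open>*\<close> is the pointwise product.\<close>

definition conv :: "('x list \<Rightarrow> 'k::field) \<Rightarrow> ('x list \<Rightarrow> 'k) \<Rightarrow> 'x list \<Rightarrow> 'k" (infixl "\<star>" 70) where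
  "f \<star> g = (\<lambda>w. \<Sum>i\<le>length w. f (take i w) * g (drop i w))"

definition scale :: "'k::field \<Rightarrow> ('x \<Rightarrow> 'k) \<Rightarrow> 'x \<Rightarrow> 'k" (infixr "\<bullet>" 75) where
  "c \<bullet> f = (\<lambda>w. c * f w)"

lemma scale_apply [simp]: "(c \<bullet> f) w = c * f w"
  by (simp add: scale_def)

definition free_carrier :: "'x set \<Rightarrow> ('x list \<Rightarrow> 'k::field) set" where
  "free_carrier X = {f. finite {w. f w \<noteq> 0} \<and> (\<forall>w. f w \<noteq> 0 \<longrightarrow> w \<noteq> [] \<and> set w \<subseteq> X)}"

text \<open>\<open>lin h\<close> is the linear extension of \<open>h\<close> from the basis of monomials to all functions of finite
  support. Identities between elements of the free algebra are proved by applying every \<open>lin h\<close>,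
  because there the product becomes a nested evaluation (\<open>lin_conv\<close>).\<close>

definition lin :: "('x \<Rightarrow> 'k::field) \<Rightarrow> ('x \<Rightarrow> 'k) \<Rightarrow> 'k" where
  "lin h a = (\<Sum>w | a w \<noteq> 0. a w * h w)"

lemma lin_superset:
  assumes "finite A" "{w. a w \<noteq> 0} \<subseteq> A"
  shows "lin h a = (\<Sum>w\<in>A. a w * h w)"
  unfolding lin_def using assms by (intro sum.mono_neutral_left) auto

text \<open>The coefficients of an element are themselves values of linear extensions.\<close>

lemma lin_indicator:
  assumes "finite {w. a w \<noteq> 0}"
  shows "lin (\<lambda>w. if w = u then 1 else 0) a = a u"
  by (subst lin_superset[of "insert u {w. a w \<noteq> 0}"]) (use assms in \<open>auto simp: if_distrib sum.If_cases\<close>)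

lemma lin_monomial [simp]: "lin h (monomial u) = h u"
  by (subst lin_superset[of "{u}"]) (auto simp: monomial_def)

lemma finite_support_diff:
  fixes a b :: "'x \<Rightarrow> 'k::field"
  assumes "finite {w. a w \<noteq> 0}" "finite {w. b w \<noteq> 0}"
  shows "finite {w. (a - b) w \<noteq> 0}"
  by (rule finite_subset[of _ "{w. a w \<noteq> 0} \<union> {w. b w \<noteq> 0}"]) (use assms in auto)

lemma lin_diff:
  assumes "finite {w. a w \<noteq> 0}" "finite {w. b w \<noteq> 0}"
  shows "lin h (a - b) = lin h a - lin h b"
proof -
  let ?A = "{w. a w \<noteq> 0} \<union> {w. b w \<noteq> 0}"
  have "lin h (a - b) = (\<Sum>w\<in>?A. (a - b) w * h w)"
    by (rule lin_superset) (use assms in auto)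
  also have "\<dots> = (\<Sum>w\<in>?A. a w * h w) - (\<Sum>w\<in>?A. b w * h w)"
    by (simp add: algebra_simps sum_subtractf)
  also have "\<dots> = lin h a - lin h b"
    using assms by (subst (1 2) lin_superset[of ?A]) auto
  finally show ?thesis .
qed

lemma lin_zero [simp]: "lin (\<lambda>w. 0) a = 0" "lin h 0 = 0"
  by (simp_all add: lin_def)

lemma lin_scale: "lin h (c \<bullet> a) = c * lin h a"
proof (cases "c = 0")
  case True
  then show ?thesis by (simp add: lin_def)
next
  case False
  then show ?thesis by (simp add: lin_def sum_distrib_left mult.assoc)
qed

lemma lin_sum:
  assumes "finite A" "\<And>i. i \<in> A \<Longrightarrow> finite {w. f i w \<noteq> 0}"
  shows "lin h (\<lambda>w. \<Sum>i\<in>A. f i w) = (\<Sum>i\<in>A. lin h (f i))"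
proof -
  let ?W = "\<Union>i\<in>A. {w. f i w \<noteq> 0}"
  have "{w. (\<Sum>i\<in>A. f i w) \<noteq> 0} \<subseteq> ?W"
    by (auto elim: sum.not_neutral_contains_not_neutral)
  then have "lin h (\<lambda>w. \<Sum>i\<in>A. f i w) = (\<Sum>w\<in>?W. \<Sum>i\<in>A. f i w * h w)"
    using assms by (subst lin_superset[of ?W]) (auto simp: sum_distrib_right)
  also have "\<dots> = (\<Sum>i\<in>A. \<Sum>w\<in>?W. f i w * h w)" by (rule sum.swap)
  also have "\<dots> = (\<Sum>i\<in>A. lin h (f i))"
    using assms by (intro sum.cong refl lin_superset[symmetric]) auto
  finally show ?thesis .
qed

lemma bij_betw_splits: "bij_betw (\<lambda>i. (take i w, drop i w)) {..length w} {(u, v). u @ v = w}"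
  by (rule bij_betwI[where g = "\<lambda>(u, v). length u"]) auto

lemma conv_eq_sum_pairs:
  "(a \<star> b) w = (\<Sum>(u, v) | u @ v = w. a u * b v)"
proof -
  from sum.reindex_bij_betw[OF bij_betw_splits, of "\<lambda>(u, v). a u * b v" w]
  show ?thesis by (simp add: conv_def)
qed

lemma conv_support: "{w. (a \<star> b) w \<noteq> 0} \<subseteq> (\<lambda>(u, v). u @ v) ` ({u. a u \<noteq> 0} \<times> {v. b v \<noteq> 0})"
proof
  fix w assume "w \<in> {w. (a \<star> b) w \<noteq> 0}"
  then obtain i where "a (take i w) * b (drop i w) \<noteq> 0"
    by (auto simp: conv_def elim: sum.not_neutral_contains_not_neutral)
  then show "w \<in> (\<lambda>(u, v). u @ v) ` ({u. a u \<noteq> 0} \<times> {v. b v \<noteq> 0})"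
    by (intro image_eqI[of _ _ "(take i w, drop i w)"]) auto
qed

lemma finite_conv_support:
  assumes "finite {w. a w \<noteq> 0}" "finite {w. b w \<noteq> 0}"
  shows "finite {w. (a \<star> b) w \<noteq> 0}"
  by (rule finite_subset[OF conv_support]) (use assms in auto)

lemma lin_conv:
  assumes "finite {w. a w \<noteq> 0}" "finite {w. b w \<noteq> 0}"
  shows "lin h (a \<star> b) = lin (\<lambda>u. lin (\<lambda>v. h (u @ v)) b) a"
proof -
  let ?P = "{u. a u \<noteq> 0} \<times> {v. b v \<noteq> 0}"
  let ?W = "(\<lambda>(u, v). u @ v) ` ?P"
  have "(a \<star> b) w = (\<Sum>p\<in>{p\<in>?P. (case p of (u, v) \<Rightarrow> u @ v) = w}. a (fst p) * b (snd p))" for w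
  proof -
    have "finite {(u, v). u @ v = w}"
      using bij_betw_finite[OF bij_betw_splits[of w]] by simp
    then show ?thesis
      unfolding conv_eq_sum_pairs by (intro sum.mono_neutral_cong_right) auto
  qed
  then have "lin h (a \<star> b) = (\<Sum>w\<in>?W. (\<Sum>p\<in>{p\<in>?P. (case p of (u, v) \<Rightarrow> u @ v) = w}.
      a (fst p) * b (snd p) * h (fst p @ snd p)))"
    by (subst lin_superset[OF _ conv_support]) 
      (use assms in \<open>auto simp: sum_distrib_right intro!: sum.cong\<close>)
  also have "\<dots> = (\<Sum>p\<in>?P. a (fst p) * b (snd p) * h (fst p @ snd p))"
    using assms by (intro sum.image_gen[symmetric]) auto
  also have "\<dots> = lin (\<lambda>u. lin (\<lambda>v. h (u @ v)) b) a"
    by (simp add: lin_def sum.cartesian_product sum_distrib_left mult.assoc case_prod_beta)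
  finally show ?thesis .
qed

lemma conv_assoc:
  assumes "finite {w. a w \<noteq> 0}" "finite {w. b w \<noteq> 0}" "finite {w. c w \<noteq> 0}"
  shows "(a \<star> b) \<star> c = a \<star> (b \<star> c)"
proof
  fix w
  let ?h = "\<lambda>v::'a list. if v = w then 1 else (0::'b)"
  have "lin ?h ((a \<star> b) \<star> c) = lin ?h (a \<star> (b \<star> c))"
    using assms by (simp add: lin_conv finite_conv_support)
  then show "((a \<star> b) \<star> c) w = (a \<star> (b \<star> c)) w"
    using assms by (simp add: lin_indicator finite_conv_support)
qed

lemma conv_diff_left: "(a - b) \<star> c = a \<star> c - b \<star> c"
  by (rule ext) (simp add: conv_def sum_subtractf algebra_simps)

lemma conv_diff_right: "c \<star> (a - b) = c \<star> a - c \<star> b"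
  by (rule ext) (simp add: conv_def sum_subtractf algebra_simps)

lemma conv_zero [simp]: "0 \<star> a = 0" "a \<star> 0 = 0"
  by (rule ext, simp add: conv_def)+

lemma scale_conv: "c \<bullet> (a \<star> b) = (c \<bullet> a) \<star> b"
  by (rule ext) (simp add: conv_def sum_distrib_left mult.assoc)

lemma conv_scale: "c \<bullet> (a \<star> b) = a \<star> (c \<bullet> b)"
  by (rule ext) (simp add: conv_def sum_distrib_left algebra_simps)

lemma monomial_conv: "monomial u \<star> monomial v = monomial (u @ v)"
proof
  fix w
  let ?h = "\<lambda>v::'a list. if v = w then 1 else (0::'b)"
  have fin: "finite {w. monomial u w \<noteq> (0::'b)}" for u :: "'a list" by (simp add: monomial_def)
  have "lin ?h (monomial u \<star> monomial v) = lin ?h (monomial (u @ v))"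
    by (simp add: lin_conv fin)
  then show "(monomial u \<star> monomial v) w = (monomial (u @ v) w :: 'b)"
    by (simp only: lin_indicator finite_conv_support fin)
qed

lemma carrier_free_algebra: "carrier (free_algebra K X) = free_carrier X"
  by (simp add: free_algebra_def free_carrier_def)

lemma mult_free_algebra: "monoid.mult (free_algebra K X) = conv"
  by (simp add: free_algebra_def conv_def fun_eq_iff)

lemma add_free_algebra: "add (free_algebra K X) = (+)"
  by (simp add: free_algebra_def fun_eq_iff)

lemma zero_free_algebra: "zero (free_algebra K X) = 0"
  by (simp add: free_algebra_def fun_eq_iff)

lemma smult_free_algebra: "smult (free_algebra K X) = scale"
  by (simp add: free_algebra_def fun_eq_iff)

lemmas free_algebra_simps = carrier_free_algebra mult_free_algebra add_free_algebra
  zero_free_algebra smult_free_algebra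

lemma free_carrier_finite: "a \<in> free_carrier X \<Longrightarrow> finite {w. a w \<noteq> 0}"
  by (simp add: free_carrier_def)

lemma free_carrier_zero [simp]: "0 \<in> free_carrier X"
  by (simp add: free_carrier_def)

lemma free_carrier_diff:
  assumes "a \<in> free_carrier X" "b \<in> free_carrier X"
  shows "a - b \<in> free_carrier X"
proof -
  have "a w \<noteq> 0 \<or> b w \<noteq> 0" if "(a - b) w \<noteq> 0" for w using that by auto
  then show ?thesis
    using assms unfolding free_carrier_def by (blast intro: finite_support_diff)
qed

lemma free_carrier_conv:
  assumes "a \<in> free_carrier X" "b \<in> free_carrier X"
  shows "a \<star> b \<in> free_carrier X"
  using assms conv_support[of a b] finite_conv_support[of a b]
  by (fastforce simp: free_carrier_def)

lemma free_carrier_scale: "a \<in> free_carrier X \<Longrightarrow> c \<bullet> a \<in> free_carrier X"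
  by (auto simp: free_carrier_def)

lemma free_carrier_monomial: "monomial w \<in> free_carrier X \<longleftrightarrow> w \<noteq> [] \<and> set w \<subseteq> X"
  by (auto simp: free_carrier_def monomial_def)

lemma abelian_group_free_algebra:
  fixes K :: "'k::field itself" and X :: "'x set"
  shows "abelian_group (free_algebra K X)"
proof (rule abelian_groupI, unfold free_algebra_simps)
  fix x y z :: "'x list \<Rightarrow> 'k" assume x: "x \<in> free_carrier X" and y: "y \<in> free_carrier X"
  from free_carrier_diff[OF x free_carrier_diff[OF free_carrier_zero y]]
  show "x + y \<in> free_carrier X" by simp
  show "x + y = y + x" by (rule add.commute)
  show "x + y + z = x + (y + z)" by (rule add.assoc)
  show "\<exists>y\<in>free_carrier X. y + x = 0"
    using free_carrier_diff[OF free_carrier_zero x] by (intro bexI[of _ "0 - x"]) auto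
qed simp_all

lemma a_inv_free_algebra:
  assumes "a \<in> free_carrier X"
  shows "a_inv (free_algebra K X) a = - a"
proof -
  interpret abelian_group "free_algebra K X" by (rule abelian_group_free_algebra)
  have "- a \<in> free_carrier X" using free_carrier_diff[OF free_carrier_zero assms] by simp
  then show ?thesis using assms
    by (intro minus_equality) (simp_all add: free_algebra_simps)
qed

lemma two_sided_ideal_free_algebra_iff:
  "two_sided_ideal (free_algebra K X) I \<longleftrightarrow>
     I \<subseteq> free_carrier X \<and> 0 \<in> I \<and> (\<forall>a\<in>I. \<forall>b\<in>I. a - b \<in> I) \<and>
     (\<forall>a\<in>I. \<forall>x\<in>free_carrier X. x \<star> a \<in> I \<and> a \<star> x \<in> I)" (is "?l \<longleftrightarrow> ?r")
proof
  interpret F: abelian_group "free_algebra K X" by (rule abelian_group_free_algebra)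
  {
    assume l: ?l
    then interpret additive_subgroup I "free_algebra K X" by (simp add: two_sided_ideal_def)
    have sub: "I \<subseteq> free_carrier X" using a_subset by (simp add: free_algebra_simps)
    have "a - b \<in> I" if "a \<in> I" "b \<in> I" for a b
      using a_closed[OF that(1) a_inv_closed[OF that(2)]] that sub
      by (simp add: free_algebra_simps a_inv_free_algebra subset_iff)
    then show ?r using l zero_closed sub
      by (simp add: two_sided_ideal_def free_algebra_simps)
  next
    assume r: ?r
    then have minus: "- a \<in> I" if "a \<in> I" for a
      using that by (metis diff_0)
    then have "a + b \<in> I" if "a \<in> I" "b \<in> I" for a b
      using r that by (metis diff_minus_eq_add)
    then have "subgroup I (add_monoid (free_algebra K X))"
      using r minus
      by (intro F.add.subgroupI) (auto simp: free_algebra_simps a_inv_free_algebra subset_iff simp flip: a_inv_def)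
    then show ?l using r
      by (simp add: two_sided_ideal_def free_algebra_simps additive_subgroup_def)
  }
qed

section \<open>Ideals of the free algebra\<close>

lemma two_sided_idealD:
  assumes "two_sided_ideal (free_algebra (K :: 'k::field itself) X) I"
  shows two_sided_ideal_subset: "I \<subseteq> free_carrier X"
    and two_sided_ideal_zero: "0 \<in> I"
    and two_sided_ideal_diff: "\<lbrakk>a \<in> I; b \<in> I\<rbrakk> \<Longrightarrow> a - b \<in> I"
    and two_sided_ideal_add: "\<lbrakk>a \<in> I; b \<in> I\<rbrakk> \<Longrightarrow> a + b \<in> I"
    and two_sided_ideal_left: "\<lbrakk>a \<in> I; x \<in> free_carrier X\<rbrakk> \<Longrightarrow> x \<star> a \<in> I"
    and two_sided_ideal_right: "\<lbrakk>a \<in> I; x \<in> free_carrier X\<rbrakk> \<Longrightarrow> a \<star> x \<in> I"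
proof -
  note * = assms[unfolded two_sided_ideal_free_algebra_iff]
  show "I \<subseteq> free_carrier X" "0 \<in> I" "\<lbrakk>a \<in> I; b \<in> I\<rbrakk> \<Longrightarrow> a - b \<in> I"
    "\<lbrakk>a \<in> I; x \<in> free_carrier X\<rbrakk> \<Longrightarrow> x \<star> a \<in> I" "\<lbrakk>a \<in> I; x \<in> free_carrier X\<rbrakk> \<Longrightarrow> a \<star> x \<in> I"
    using * by blast+
  show "a + b \<in> I" if "a \<in> I" "b \<in> I"
  proof -
    have "a - (0 - b) \<in> I" using * that by blast
    then show ?thesis by simp
  qed
qed

lemma two_sided_ideal_sum:
  assumes "two_sided_ideal (free_algebra (K :: 'k::field itself) X) I" "\<And>i. i \<in> A \<Longrightarrow> f i \<in> I"
  shows "(\<lambda>w. \<Sum>i\<in>A. f i w) \<in> I"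
  using assms(2)
proof (induction A rule: infinite_finite_induct)
  case (insert i A)
  then have "f i + (\<lambda>w. \<Sum>i\<in>A. f i w) \<in> I"
    by (intro two_sided_ideal_add[OF assms(1)]) auto
  moreover have "f i + (\<lambda>w. \<Sum>i\<in>A. f i w) = (\<lambda>w. \<Sum>i\<in>insert i A. f i w)"
    using insert by (auto simp: fun_eq_iff)
  ultimately show ?case by simp
qed (use two_sided_ideal_zero[OF assms(1)] in \<open>auto simp: zero_fun_def\<close>)

lemma monomial_Nil_conv [simp]: "monomial [] \<star> a = a"
proof
  fix w
  have "(monomial [] \<star> a) w = (\<Sum>i\<in>{0}. monomial [] (take i w) * a (drop i w))"
    unfolding conv_def by (rule sum.mono_neutral_right) (auto simp: monomial_def)
  then show "(monomial [] \<star> a) w = a w" by (simp add: monomial_def)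
qed

lemma conv_monomial_Nil [simp]: "a \<star> monomial [] = a"
proof
  fix w
  have "(a \<star> monomial []) w = (\<Sum>i\<in>{length w}. a (take i w) * monomial [] (drop i w))"
    unfolding conv_def by (rule sum.mono_neutral_right) (auto simp: monomial_def)
  then show "(a \<star> monomial []) w = a w" by (simp add: monomial_def)
qed

lemma finite_monomial [simp]: "finite {w. monomial u w \<noteq> (0::'k::field)}"
  by (simp add: monomial_def)

text \<open>The words \<open>p\<close> and \<open>q\<close> may be empty. The monomial of the empty word is not in the free algebra,
  but multiplying by it is harmless, and allowing it avoids case distinctions in word rewriting.\<close>

lemma two_sided_ideal_monomials:
  assumes "two_sided_ideal (free_algebra (K :: 'k::field itself) X) I" "a \<in> I"
    and "set p \<subseteq> X" "set q \<subseteq> X"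
  shows "monomial p \<star> a \<star> monomial q \<in> I"
proof -
  have "monomial p \<star> a \<in> I"
    using assms by (cases "p = []") (auto intro!: two_sided_ideal_left[OF assms(1)] simp: free_carrier_monomial)
  then show ?thesis
    using assms by (cases "q = []") (auto intro!: two_sided_ideal_right[OF assms(1)] simp: free_carrier_monomial)
qed

lemma two_sided_ideal_free_carrier: "two_sided_ideal (free_algebra K X) (free_carrier X)"
  by (auto simp: two_sided_ideal_free_algebra_iff intro: free_carrier_diff free_carrier_conv)

lemma conv_sum_right: "c \<star> (\<lambda>w. \<Sum>i\<in>A. f i w) = (\<lambda>w. \<Sum>i\<in>A. (c \<star> f i) w)"
  unfolding conv_def by (rule ext) (simp add: sum_distrib_left sum.swap[of _ A])

lemma conv_sum_left: "(\<lambda>w. \<Sum>i\<in>A. f i w) \<star> c = (\<lambda>w. \<Sum>i\<in>A. (f i \<star> c) w)"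
  unfolding conv_def by (rule ext) (simp add: sum_distrib_right sum.swap[of _ A])

lemma decompose_monomials:
  assumes "finite {w. a w \<noteq> 0}"
  shows "a = (\<lambda>w. \<Sum>u | a u \<noteq> 0. (a u \<bullet> monomial u) w)"
proof
  fix w
  have "(\<Sum>u | a u \<noteq> 0. (a u \<bullet> monomial u) w) = (\<Sum>u | a u \<noteq> 0. if u = w then a u else 0)"
    by (intro sum.cong) (auto simp: monomial_def)
  then show "a w = (\<Sum>u | a u \<noteq> 0. (a u \<bullet> monomial u) w)"
    using assms by (simp add: sum.delta)
qed

lemma algebra_ideal_free_algebra_iff:
  "algebra_ideal (free_algebra K X) I \<longleftrightarrow> two_sided_ideal (free_algebra K X) I \<and> (\<forall>c. \<forall>a\<in>I. c \<bullet> a \<in> I)"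
  by (simp add: algebra_ideal_def free_algebra_simps)

lemma generated_algebra_ideal:
  assumes "S \<subseteq> free_carrier X"
  shows algebra_ideal_generated: "algebra_ideal (free_algebra K X) (generated_algebra_ideal (free_algebra K X) S)"
    and subset_generated_algebra_ideal: "S \<subseteq> generated_algebra_ideal (free_algebra K X) S"
proof -
  let ?C = "{I. algebra_ideal (free_algebra K X) I \<and> S \<subseteq> I}"
  have "free_carrier X \<in> ?C"
    using assms by (auto simp: algebra_ideal_free_algebra_iff two_sided_ideal_free_carrier free_carrier_scale)
  then have sub: "\<Inter>?C \<subseteq> free_carrier X" by blast
  show "algebra_ideal (free_algebra K X) (generated_algebra_ideal (free_algebra K X) S)"
    unfolding generated_algebra_ideal_def algebra_ideal_free_algebra_iff[where I = "\<Inter>?C"]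
      two_sided_ideal_free_algebra_iff[where I = "\<Inter>?C"]
  proof (intro conjI ballI allI)
    show "\<Inter>?C \<subseteq> free_carrier X" by (rule sub)
  qed (auto simp: algebra_ideal_free_algebra_iff two_sided_ideal_free_algebra_iff)
  show "S \<subseteq> generated_algebra_ideal (free_algebra K X) S"
    by (auto simp: generated_algebra_ideal_def)
qed

lemma two_sided_ideal_generated:
  assumes "S \<subseteq> free_carrier X"
  shows "two_sided_ideal (free_algebra K X) (generated_ideal (free_algebra K X) S)"
proof -
  let ?C = "{I. two_sided_ideal (free_algebra K X) I \<and> S \<subseteq> I}"
  have "free_carrier X \<in> ?C"
    using assms by (auto simp: two_sided_ideal_free_carrier)
  then have sub: "\<Inter>?C \<subseteq> free_carrier X" by blast
  show ?thesis
    unfolding generated_ideal_def two_sided_ideal_free_algebra_iff[where I = "\<Inter>?C"]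
  proof (intro conjI ballI allI)
    show "\<Inter>?C \<subseteq> free_carrier X" by (rule sub)
  qed (auto simp: two_sided_ideal_free_algebra_iff)
qed

lemma rng_epimorphism_quotient_algebra:
  fixes K :: "'k::field itself" and X :: "'x set"
  assumes I: "two_sided_ideal (free_algebra K X) I"
  shows "rng_epimorphism (free_algebra K X) (quotient_algebra (free_algebra K X) I) (\<lambda>a. I +>\<^bsub>free_algebra K X\<^esub> a)"
    and "a_kernel (free_algebra K X) (quotient_algebra (free_algebra K X) I) (\<lambda>a. I +>\<^bsub>free_algebra K X\<^esub> a) = I"
proof -
  let ?F = "free_algebra K X"
  let ?Q = "quotient_algebra ?F I"
  interpret F: abelian_group ?F by (rule abelian_group_free_algebra)
  interpret I: abelian_subgroup I ?F
    using I by (intro abelian_subgroupI3 F.abelian_group_axioms) (simp add: two_sided_ideal_def)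
  have carQ: "carrier ?Q = (\<lambda>a. I +>\<^bsub>?F\<^esub> a) ` free_carrier X"
    by (auto simp: quotient_algebra_def FactRing_def A_RCOSETS_def' free_algebra_simps)
  have addQ: "(I +>\<^bsub>?F\<^esub> a) \<oplus>\<^bsub>?Q\<^esub> (I +>\<^bsub>?F\<^esub> b) = I +>\<^bsub>?F\<^esub> (a + b)"
    if "a \<in> free_carrier X" "b \<in> free_carrier X" for a b
    using I.a_rcos_sum[of a b] that by (simp add: quotient_algebra_def FactRing_def free_algebra_simps)
  have zeroI: "I +>\<^bsub>?F\<^esub> 0 = I"
    using F.a_coset_add_zero[of I] two_sided_ideal_subset[OF I] by (simp add: free_algebra_simps)
  then have zeroQ: "\<zero>\<^bsub>?Q\<^esub> = I +>\<^bsub>?F\<^esub> 0" by (simp add: quotient_algebra_def FactRing_def)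
  have coset_eq: "I +>\<^bsub>?F\<^esub> a = I +>\<^bsub>?F\<^esub> b \<longleftrightarrow> a - b \<in> I"
    if a: "a \<in> free_carrier X" and b: "b \<in> free_carrier X" for a b
  proof -
    have "I +>\<^bsub>?F\<^esub> a = I +>\<^bsub>?F\<^esub> b \<longleftrightarrow> a \<in> I +>\<^bsub>?F\<^esub> b"
      using I.a_repr_independence'[of a b] I.a_rcos_self[of a] a b by (auto simp: free_algebra_simps)
    also have "\<dots> \<longleftrightarrow> a - b \<in> I"
      using I.a_rcos_module[of b a] a b by (simp add: free_algebra_simps a_inv_free_algebra)
    finally show ?thesis .
  qed
  have multQ: "(I +>\<^bsub>?F\<^esub> a) \<otimes>\<^bsub>?Q\<^esub> (I +>\<^bsub>?F\<^esub> b) = I +>\<^bsub>?F\<^esub> (a \<star> b)"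
    if a: "a \<in> free_carrier X" and b: "b \<in> free_carrier X" for a b
  proof -
    have "I +>\<^bsub>?F\<^esub> (x \<star> y) = I +>\<^bsub>?F\<^esub> (a \<star> b)"
      if x: "x \<in> I +>\<^bsub>?F\<^esub> a" and y: "y \<in> I +>\<^bsub>?F\<^esub> b" for x y
    proof -
      have xy: "x \<in> free_carrier X" "y \<in> free_carrier X"
        using I.a_elemrcos_carrier[of a x] I.a_elemrcos_carrier[of b y] a b x y
        by (auto simp: free_algebra_simps)
      have "x - a \<in> I" "y - b \<in> I"
        using I.a_rcos_module[of a x] I.a_rcos_module[of b y] a b x y xy
        by (simp_all add: free_algebra_simps a_inv_free_algebra)
      then have "x \<star> (y - b) + (x - a) \<star> b \<in> I"
        using xy b by (intro two_sided_ideal_add[OF I] two_sided_ideal_left[OF I] two_sided_ideal_right[OF I])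
      then have "x \<star> y - a \<star> b \<in> I" by (simp add: conv_diff_left conv_diff_right)
      then show ?thesis using coset_eq xy a b free_carrier_conv by blast
    qed
    moreover have "a \<in> I +>\<^bsub>?F\<^esub> a" "b \<in> I +>\<^bsub>?F\<^esub> b"
      using I.a_rcos_self a b by (auto simp: free_algebra_simps)
    ultimately have "(\<Union>x\<in>I +>\<^bsub>?F\<^esub> a. \<Union>y\<in>I +>\<^bsub>?F\<^esub> b. I +>\<^bsub>?F\<^esub> (x \<star> y)) = I +>\<^bsub>?F\<^esub> (a \<star> b)"
      by blast
    then show ?thesis
      by (simp add: quotient_algebra_def FactRing_def rcoset_mult_def mult_free_algebra)
  qed
  have add_closed: "a + b \<in> free_carrier X" if "a \<in> free_carrier X" "b \<in> free_carrier X" 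
    for a b :: "'x list \<Rightarrow> 'k"
    using that two_sided_ideal_add[OF two_sided_ideal_free_carrier] by blast
  have "abelian_group ?Q"
  proof (rule abelian_groupI)
    fix x assume "x \<in> carrier ?Q"
    then obtain a where a: "a \<in> free_carrier X" "x = I +>\<^bsub>?F\<^esub> a" by (auto simp: carQ)
    have "0 - a \<in> free_carrier X" using a by (intro free_carrier_diff) auto
    then show "\<exists>y\<in>carrier ?Q. y \<oplus>\<^bsub>?Q\<^esub> x = \<zero>\<^bsub>?Q\<^esub>"
      using a by (intro bexI[of _ "I +>\<^bsub>?F\<^esub> (0 - a)"]) (auto simp: addQ carQ zeroQ)
    show "\<zero>\<^bsub>?Q\<^esub> \<oplus>\<^bsub>?Q\<^esub> x = x" 
      using addQ[of 0 a] a by (simp add: zeroQ)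
  next
    show "\<zero>\<^bsub>?Q\<^esub> \<in> carrier ?Q" by (auto simp: zeroQ carQ)
  qed (auto simp: carQ addQ add_closed add_ac)
  moreover have "group_hom (add_monoid ?F) (add_monoid ?Q) (\<lambda>a. I +>\<^bsub>?F\<^esub> a)"
    by (intro group_hom.intro group_hom_axioms.intro abelian_group.a_group[OF calculation] F.a_group)
      (auto simp: hom_def carQ addQ free_algebra_simps)
  ultimately show "rng_epimorphism ?F ?Q (\<lambda>a. I +>\<^bsub>?F\<^esub> a)"
    by (intro rng_epimorphism.intro abelian_group_homI abelian_group_free_algebra rng_epimorphism_axioms.intro)
      (auto simp: carQ multQ free_algebra_simps free_carrier_conv)
  show "a_kernel ?F ?Q (\<lambda>a. I +>\<^bsub>?F\<^esub> a) = I"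
    using two_sided_ideal_subset[OF I] coset_eq[OF _ free_carrier_zero]
    unfolding a_kernel_def' zeroQ carrier_free_algebra by auto
qed

section \<open>The ideal of a hereditary saturated set\<close>

locale leavitt = row_finite_graph E for E :: "('v, 'e) pre_digraph" +
  fixes K :: "'k::field itself" and H :: "'v set"
  assumes H_subset: "H \<subseteq> verts E"
    and hered: "hereditary E H"
    and sat: "saturated E H"
begin

abbreviation "X \<equiv> generators E"
abbreviation "F \<equiv> (free_carrier X :: (('v, 'e) generator list \<Rightarrow> 'k) set)"
abbreviation "R \<equiv> leavitt_ideal K E"
abbreviation mon :: "('v, 'e) generator list \<Rightarrow> ('v, 'e) generator list \<Rightarrow> 'k" where
  "mon w \<equiv> monomial w"

text \<open>The preimage of \<open>I(H)\<close> in the free algebra; see \<open>vertex_ideal_eq\<close>.\<close>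

definition vertex_preideal :: "(('v, 'e) generator list \<Rightarrow> 'k) set" where
  "vertex_preideal = generated_ideal (free_algebra K X) (R \<union> (\<lambda>v. mon [Vertex v]) ` H)"

lemma generators_simps [simp]:
  "Vertex v \<in> X \<longleftrightarrow> v \<in> verts E" "Edge e \<in> X \<longleftrightarrow> e \<in> arcs E" "Ghost e \<in> X \<longleftrightarrow> e \<in> arcs E"
  by (auto simp: generators_def)

lemma mon_in_F: "mon w \<in> F \<longleftrightarrow> w \<noteq> [] \<and> set w \<subseteq> X"
  by (rule free_carrier_monomial)

lemma leavitt_relators_eq: "leavitt_relators K E = {a - b | a b. (a, b) \<in> leavitt_relations E}"
  unfolding leavitt_relators_def fun_diff_def ..

lemma leavitt_relators_subset: "leavitt_relators K E \<subseteq> F"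
proof -
  have "a \<in> F \<and> b \<in> F" if "(a, b) \<in> leavitt_relations E" for a b
    using that
  proof induction
    case (vertex_sum v)
    then show ?case
      by (auto simp: mon_in_F intro!: two_sided_ideal_sum[OF two_sided_ideal_free_carrier])
  qed (use free_carrier_zero[of X] in \<open>auto simp: mon_in_F zero_fun_def\<close>)
  then show ?thesis
    by (auto simp: leavitt_relators_eq intro!: free_carrier_diff)
qed

lemma R_algebra_ideal: "algebra_ideal (free_algebra K X) R"
  unfolding leavitt_ideal_def by (rule algebra_ideal_generated[OF leavitt_relators_subset])

lemma R_two_sided: "two_sided_ideal (free_algebra K X) R"
  using R_algebra_ideal by (simp add: algebra_ideal_free_algebra_iff)

lemma R_scale: "a \<in> R \<Longrightarrow> c \<bullet> a \<in> R"
  using R_algebra_ideal by (simp add: algebra_ideal_free_algebra_iff)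

lemma relation_in_R: "(a, b) \<in> leavitt_relations E \<Longrightarrow> a - b \<in> R"
  using subset_generated_algebra_ideal[OF leavitt_relators_subset]
  unfolding leavitt_ideal_def leavitt_relators_eq by blast

lemma relation_zero_in_R: "(a, \<lambda>_. 0) \<in> leavitt_relations E \<Longrightarrow> a \<in> R"
  using relation_in_R[of a "\<lambda>_. 0"] by (simp add: fun_diff_def)

lemma R_minimal:
  assumes "algebra_ideal (free_algebra K X) J" "\<And>a b. (a, b) \<in> leavitt_relations E \<Longrightarrow> a - b \<in> J"
  shows "R \<subseteq> J"
  unfolding leavitt_ideal_def generated_algebra_ideal_def
  using assms by (intro Inter_lower) (auto simp: leavitt_relators_eq)

lemma rng_epimorphism_proj:
  "rng_epimorphism (free_algebra K X) (leavitt_path_algebra K E) (\<lambda>a. R +>\<^bsub>free_algebra K X\<^esub> a)"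
  unfolding leavitt_path_algebra_def by (rule rng_epimorphism_quotient_algebra(1)[OF R_two_sided])

lemma kernel_proj:
  "a_kernel (free_algebra K X) (leavitt_path_algebra K E) (\<lambda>a. R +>\<^bsub>free_algebra K X\<^esub> a) = R"
  unfolding leavitt_path_algebra_def by (rule rng_epimorphism_quotient_algebra(2)[OF R_two_sided])

lemma vertex_generators_subset: "R \<union> (\<lambda>v. mon [Vertex v]) ` H \<subseteq> F"
  using H_subset two_sided_ideal_subset[OF R_two_sided] by (auto simp: mon_in_F)

lemma vertex_preideal_two_sided: "two_sided_ideal (free_algebra K X) vertex_preideal"
  unfolding vertex_preideal_def by (rule two_sided_ideal_generated[OF vertex_generators_subset])

lemma R_subset_vertex_preideal: "R \<subseteq> vertex_preideal"
  and vertex_in_preideal: "v \<in> H \<Longrightarrow> mon [Vertex v] \<in> vertex_preideal"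
  by (auto simp: vertex_preideal_def generated_ideal_def)

lemma vertex_preideal_minimal:
  assumes "two_sided_ideal (free_algebra K X) J" "R \<subseteq> J" "\<And>v. v \<in> H \<Longrightarrow> mon [Vertex v] \<in> J"
  shows "vertex_preideal \<subseteq> J"
  unfolding vertex_preideal_def generated_ideal_def using assms by (intro Inter_lower) auto

lemma vertex_ideal_eq:
  "vertex_ideal K E H = (\<lambda>a. R +>\<^bsub>free_algebra K X\<^esub> a) ` vertex_preideal"
proof -
  have "leavitt_vertex K E ` H = (\<lambda>a. R +>\<^bsub>free_algebra K X\<^esub> a) ` ((\<lambda>v. mon [Vertex v]) ` H)"
    by (simp add: leavitt_vertex_def image_image)
  then show ?thesis
    unfolding vertex_ideal_def vertex_preideal_def
    using rng_epimorphism.generated_ideal_image[OF rng_epimorphism_proj, of "(\<lambda>v. mon [Vertex v]) ` H"] vertex_generators_subset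
    by (simp add: kernel_proj carrier_free_algebra)
qed

lemma prime_vertex_ideal_iff:
  "prime_ideal (leavitt_path_algebra K E) (vertex_ideal K E H) \<longleftrightarrow> vertex_preideal \<noteq> F \<and>
     (\<forall>A B. two_sided_ideal (free_algebra K X) A \<and> two_sided_ideal (free_algebra K X) B \<and>
        R \<subseteq> A \<and> R \<subseteq> B \<and> (\<forall>a\<in>A. \<forall>b\<in>B. a \<star> b \<in> vertex_preideal)
        \<longrightarrow> A \<subseteq> vertex_preideal \<or> B \<subseteq> vertex_preideal)"
  unfolding vertex_ideal_eq
  using rng_epimorphism.prime_ideal_image_iff[OF rng_epimorphism_proj vertex_preideal_two_sided] R_subset_vertex_preideal
  by (simp add: kernel_proj carrier_free_algebra mult_free_algebra)

text \<open>Equality in the Leavitt path algebra is congruence modulo \<open>R\<close>, and equal words may be exchanged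
  inside a larger word.\<close>

lemma word_cong:
  assumes "mon u - mon v \<in> R" "set p \<subseteq> X" "set q \<subseteq> X"
  shows "mon (p @ u @ q) - mon (p @ v @ q) \<in> R"
  using two_sided_ideal_monomials[OF R_two_sided assms(1,2,3)]
  by (simp add: conv_diff_left conv_diff_right monomial_conv)

lemma word_zero:
  assumes "mon u \<in> R" "set p \<subseteq> X" "set q \<subseteq> X"
  shows "mon (p @ u @ q) \<in> R"
  using two_sided_ideal_monomials[OF R_two_sided assms(1,2,3)] by (simp add: monomial_conv)

text \<open>The ideal is generated as a ring ideal, and a ring without unit may have ring ideals that are not
  subspaces. Here the elements all of whose multiples stay inside form an ideal; it contains the
  vertices of \<open>H\<close> because \<open>c v = (c v) v\<close>, hence it is everything by minimality.\<close>

lemma vertex_preideal_scale: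
  assumes "a \<in> vertex_preideal"
  shows "c \<bullet> a \<in> vertex_preideal"
proof -
  let ?I = vertex_preideal
  define Q where "Q = {a \<in> ?I. \<forall>c. c \<bullet> a \<in> ?I}"
  note I = vertex_preideal_two_sided
  have scale_diff: "c \<bullet> (a - b) = c \<bullet> a - c \<bullet> b" for c and a b :: "('v, 'e) generator list \<Rightarrow> 'k"
    by (rule ext) (simp add: algebra_simps)
  have scale_zero: "c \<bullet> 0 = (0 :: ('v, 'e) generator list \<Rightarrow> 'k)" for c by (rule ext) simp
  have "two_sided_ideal (free_algebra K X) Q"
    unfolding two_sided_ideal_free_algebra_iff
  proof (intro conjI ballI)
    show "Q \<subseteq> F" using two_sided_ideal_subset[OF I] by (auto simp: Q_def)
    show "0 \<in> Q" using two_sided_ideal_zero[OF I] by (simp add: Q_def scale_zero)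
    fix a assume a: "a \<in> Q"
    show "a - b \<in> Q" if "b \<in> Q" for b
      using a that by (auto simp: Q_def scale_diff intro: two_sided_ideal_diff[OF I])
    fix x assume x: "x \<in> F"
    show "x \<star> a \<in> Q" 
      using a x unfolding Q_def by (auto simp: conv_scale intro: two_sided_ideal_left[OF I])
    show "a \<star> x \<in> Q"
      using a x unfolding Q_def by (auto simp: scale_conv intro: two_sided_ideal_right[OF I])
  qed
  moreover have "R \<subseteq> Q"
    using R_subset_vertex_preideal R_scale by (auto simp: Q_def)
  moreover have "mon [Vertex v] \<in> Q" if v: "v \<in> H" for v
  proof -
    have "c \<bullet> mon [Vertex v] \<in> ?I" for c
    proof -
      have "mon [Vertex v, Vertex v] - mon [Vertex v] \<in> R"
        using v H_subset by (intro relation_in_R leavitt_relations.vertex_idem) auto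
      then have 1: "c \<bullet> (mon [Vertex v, Vertex v] - mon [Vertex v]) \<in> ?I"
        using R_scale R_subset_vertex_preideal by blast
      have "(c \<bullet> mon [Vertex v]) \<star> mon [Vertex v] \<in> ?I"
        using v H_subset
        by (intro two_sided_ideal_left[OF I] free_carrier_scale vertex_in_preideal) (auto simp: mon_in_F)
      then have "c \<bullet> mon [Vertex v, Vertex v] \<in> ?I"
        by (simp add: monomial_conv flip: scale_conv)
      from two_sided_ideal_diff[OF I this 1] show ?thesis by (simp add: scale_diff)
    qed
    then show ?thesis using v by (simp add: Q_def vertex_in_preideal)
  qed
  ultimately have "?I \<subseteq> Q" by (rule vertex_preideal_minimal)
  then show ?thesis using assms by (auto simp: Q_def)
qed

section \<open>Removing ghosts\<close>

text \<open>Every generator is fixed on the right by exactly one vertex and killed by all others. For a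
  ghost this vertex is the source of the edge.\<close>

fun target :: "('v, 'e) generator \<Rightarrow> 'v" where
  "target (Vertex v) = v" | "target (Edge e) = head E e" | "target (Ghost e) = tail E e"

lemma target_in_verts: "g \<in> X \<Longrightarrow> target g \<in> verts E"
  by (cases g) auto

lemma mult_target:
  assumes "g \<in> X"
  shows "mon [g, Vertex (target g)] - mon [g] \<in> R"
  using assms by (cases g) (auto intro!: relation_in_R intro: leavitt_relations.intros)

lemma mult_wrong_target:
  assumes "g \<in> X" "v \<in> verts E" "v \<noteq> target g"
  shows "mon [g, Vertex v] \<in> R"
proof -
  have "mon [Vertex (target g), Vertex v] \<in> R"
    using assms target_in_verts by (intro relation_zero_in_R leavitt_relations.vertex_orth) auto
  from word_zero[OF this, of "[g]" "[]"] have "mon [g, Vertex (target g), Vertex v] \<in> R"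
    using assms by simp
  moreover have "mon [g, Vertex (target g), Vertex v] - mon [g, Vertex v] \<in> R"
    using word_cong[OF mult_target[OF assms(1)], of "[]" "[Vertex v]"] assms by simp
  ultimately have "mon [g, Vertex (target g), Vertex v] - (mon [g, Vertex (target g), Vertex v] - mon [g, Vertex v]) \<in> R"
    by (rule two_sided_ideal_diff[OF R_two_sided])
  then show ?thesis by simp
qed

lemma cong_sym: "a - b \<in> R \<Longrightarrow> b - a \<in> R"
  using two_sided_ideal_diff[OF R_two_sided two_sided_ideal_zero[OF R_two_sided], of "a - b"] by simp

lemma cong_trans: "a - b \<in> R \<Longrightarrow> b - c \<in> R \<Longrightarrow> a - c \<in> R"
  using two_sided_ideal_add[OF R_two_sided, of "a - b" "b - c"] by simp

lemma cong_mem: 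
  assumes "two_sided_ideal (free_algebra K X) J" "R \<subseteq> J" "a - b \<in> R"
  shows "a \<in> J \<longleftrightarrow> b \<in> J"
proof
  assume "a \<in> J"
  from two_sided_ideal_diff[OF assms(1) this, of "a - b"] show "b \<in> J" using assms by auto
next
  assume "b \<in> J"
  from two_sided_ideal_add[OF assms(1) _ this, of "a - b"] show "a \<in> J" using assms by auto
qed

lemmas cong_zero = cong_mem[OF R_two_sided subset_refl]

text \<open>The leading vertex makes the word of a path of length zero nonempty.\<close>

definition path_word :: "'v \<Rightarrow> 'e list \<Rightarrow> ('v, 'e) generator list" where
  "path_word v p = Vertex v # map Edge p"

lemma path_word_generators: "awalk v p u \<Longrightarrow> set (path_word v p) \<subseteq> X"
  by (auto simp: path_word_def awalk_def)

lemma tl_path_word_generators: "awalk v p u \<Longrightarrow> set (map Edge p) \<subseteq> X"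
  by (auto simp: awalk_def)

text \<open>A vertex or an edge in front of a path gives a path or zero. A ghost cancels the first edge of the
  path or gives zero, so it costs one unit of length. If the path is trivial, a ghost \<open>e\<^sup>*\<close> that does
  not annihilate it has the end of the path as the source of \<open>e\<close>; hence a path ending in a sink never
  runs out of edges.\<close>

lemma generator_times_path:
  assumes p: "awalk v p u" and g: "g \<in> X" and long: "Suc n \<le> length p \<or> out_arcs E u = {}"
  shows "mon (g # path_word v p) \<in> R \<or>
    (\<exists>v' p'. awalk v' p' u \<and> (n \<le> length p' \<or> out_arcs E u = {}) \<and>
       mon (g # path_word v p) - mon (path_word v' p') \<in> R)"
proof (cases "target g = v")
  case False
  have "mon ([] @ [g, Vertex v] @ map Edge p) \<in> R"
    using False g p by (intro word_zero mult_wrong_target) (auto simp: awalk_def)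
  then show ?thesis by (simp add: path_word_def)
next
  case True
  have "mon ([] @ [g, Vertex v] @ map Edge p) - mon ([] @ [g] @ map Edge p) \<in> R"
    using mult_target[OF g] True p by (intro word_cong) (auto simp: awalk_def)
  then have absorb: "mon (g # path_word v p) - mon (g # map Edge p) \<in> R"
    by (simp add: path_word_def)
  show ?thesis
  proof (cases g)
    case (Vertex x)
    then have "g # map Edge p = path_word v p" using True by (simp add: path_word_def)
    then show ?thesis using absorb p long by (metis Suc_leD)
  next
    case (Edge e)
    have "mon ([] @ [Vertex (tail E e), Edge e] @ map Edge p) - mon ([] @ [Edge e] @ map Edge p) \<in> R"
      using p g Edge by (intro word_cong relation_in_R leavitt_relations.source_edge) (auto simp: awalk_def)
    then have "mon (path_word (tail E e) (e # p)) - mon (g # map Edge p) \<in> R"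
      by (simp add: path_word_def Edge)
    then have "mon (g # path_word v p) - mon (path_word (tail E e) (e # p)) \<in> R"
      using absorb cong_sym cong_trans by blast
    moreover have "awalk (tail E e) (e # p) u"
      using p g Edge True by (auto simp: awalk_Cons_iff)
    moreover have "n \<le> length (e # p) \<or> out_arcs E u = {}" using long by auto
    ultimately show ?thesis by blast
  next
    case (Ghost e)
    have e: "e \<in> arcs E" and te: "tail E e = v" using g Ghost True by auto
    show ?thesis
    proof (cases p)
      case Nil
      then have "u = v" using p by (auto simp: awalk_Nil_iff)
      then have "e \<in> out_arcs E u" using e te by simp
      then show ?thesis using long Nil by auto
    next
      case (Cons f p')
      have f: "f \<in> arcs E" "awalk (head E f) p' u" using p Cons by (auto simp: awalk_Cons_iff)
      then have p': "set (map Edge p') \<subseteq> X" using tl_path_word_generators by blast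
      show ?thesis
      proof (cases "f = e")
        case False
        have "mon ([] @ [Ghost e, Edge f] @ map Edge p') \<in> R"
          using e f False p'
          by (intro word_zero relation_zero_in_R leavitt_relations.ghost_edge_diff) auto
        then have "mon (g # map Edge p) \<in> R" by (simp add: Ghost Cons)
        then show ?thesis using cong_zero[OF absorb] by blast
      next
        case True
        have "mon ([] @ [Ghost e, Edge f] @ map Edge p') - mon ([] @ [Vertex (head E f)] @ map Edge p') \<in> R"
          using e True p' unfolding True
          by (intro word_cong relation_in_R leavitt_relations.ghost_edge_same) auto
        then have "mon (g # map Edge p) - mon (path_word (head E f) p') \<in> R"
          by (simp add: Ghost Cons path_word_def)
        then have "mon (g # path_word v p) - mon (path_word (head E f) p') \<in> R"
          using absorb cong_trans by blast
        moreover have "n \<le> length p' \<or> out_arcs E u = {}" using long Cons by auto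
        ultimately show ?thesis using f by blast
      qed
    qed
  qed
qed

text \<open>The surplus length \<open>n\<close> is what the generators further to the left may still consume.\<close>

lemma word_times_path:
  assumes "awalk v p u" "set w \<subseteq> X" "length w + n \<le> length p \<or> out_arcs E u = {}"
  shows "mon (w @ path_word v p) \<in> R \<or>
    (\<exists>v' p'. awalk v' p' u \<and> (n \<le> length p' \<or> out_arcs E u = {}) \<and>
       mon (w @ path_word v p) - mon (path_word v' p') \<in> R)"
  using assms(2,3)
proof (induction w arbitrary: n)
  case Nil
  have "mon ([] @ path_word v p) - mon (path_word v p) \<in> R"
    using two_sided_ideal_zero[OF R_two_sided] by simp
  moreover have "n \<le> length p \<or> out_arcs E u = {}" using Nil by simp
  ultimately show ?case using assms(1) by blast
next
  case (Cons g w)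
  have g: "g \<in> X" using Cons.prems by simp
  have "set w \<subseteq> X" "length w + Suc n \<le> length p \<or> out_arcs E u = {}" using Cons.prems by auto
  from Cons.IH[OF this] consider "mon (w @ path_word v p) \<in> R"
    | v' p' where "awalk v' p' u" "Suc n \<le> length p' \<or> out_arcs E u = {}"
       "mon (w @ path_word v p) - mon (path_word v' p') \<in> R"
    by blast
  then show ?case
  proof cases
    case 1
    from word_zero[OF this, of "[g]" "[]"] show ?thesis using g by simp
  next
    case (2 v' p')
    have eq: "mon ((g # w) @ path_word v p) - mon (g # path_word v' p') \<in> R"
      using word_cong[OF 2(3), of "[g]" "[]"] g by simp
    from generator_times_path[OF 2(1) g 2(2)] show ?thesis
      using cong_zero[OF eq] cong_trans[OF eq] by blast
  qed
qed

lemma vertex_eq_sum: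
  assumes "v \<in> verts E" "out_arcs E v \<noteq> {}"
  shows "mon [Vertex v] - (\<lambda>w. \<Sum>e\<in>out_arcs E v. mon [Edge e, Ghost e] w) \<in> R"
  using assms by (intro relation_in_R leavitt_relations.vertex_sum)

lemma path_word_target:
  assumes p: "awalk v p u"
  shows "mon (path_word v p @ [Vertex u]) - mon (path_word v p) \<in> R"
proof -
  let ?w = "path_word v p"
  have w: "set ?w \<subseteq> X" using p path_word_generators by blast
  define g where "g = last ?w"
  have g: "?w = butlast ?w @ [g]" by (simp add: g_def path_word_def)
  have "g \<in> X" using w by (subst (asm) g) simp
  moreover have "target g = u"
    using p by (cases p rule: rev_cases) (auto simp: g_def path_word_def awalk_Nil_iff awalk_Cons_iff)
  ultimately show ?thesis
    using word_cong[OF mult_target[of g], of "butlast ?w" "[]"] w g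
    by (metis append.assoc append_Cons append_Nil append_Nil2 empty_set empty_subsetI in_set_butlastD subset_iff)
qed

lemma path_word_in_preideal:
  assumes p: "awalk v p u" and u: "u \<in> H"
  shows "mon (path_word v p) \<in> vertex_preideal"
proof -
  have "mon (path_word v p) \<star> mon [Vertex u] \<in> vertex_preideal"
    using path_word_generators[OF p]
    by (intro two_sided_ideal_left[OF vertex_preideal_two_sided vertex_in_preideal[OF u]])
      (simp add: mon_in_F path_word_def)
  then show ?thesis
    using cong_mem[OF vertex_preideal_two_sided R_subset_vertex_preideal path_word_target[OF p]]
    by (simp add: monomial_conv)
qed

text \<open>If all the products with one more edge \<open>e\<close> were in \<open>J\<close>, then so would be those with
  \<open>e e\<^sup>*\<close>, and these add up to the product with the path itself.\<close>

lemma extend_path: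
  assumes J: "two_sided_ideal (free_algebra K X) J" "R \<subseteq> J" and x: "x \<in> F"
    and p: "awalk v p u" "x \<star> mon (path_word v p) \<notin> J" and u: "out_arcs E u \<noteq> {}"
  shows "\<exists>e\<in>out_arcs E u. x \<star> mon (path_word v (p @ [e])) \<notin> J"
proof (rule ccontr)
  assume neg: "\<not> ?thesis"
  have fin: "finite {w. x w \<noteq> 0}" using x by (rule free_carrier_finite)
  have uE: "u \<in> verts E" using p by auto
  let ?w = "path_word v p"
  have w: "set ?w \<subseteq> X" using p path_word_generators by blast
  have w_last: "mon (?w @ [Vertex u]) - mon ?w \<in> R" by (rule path_word_target[OF p(1)])
  have "x \<star> mon (?w @ [Edge e, Ghost e]) \<in> J" if e: "e \<in> out_arcs E u" for e
  proof -
    have "x \<star> mon (path_word v (p @ [e])) \<star> mon [Ghost e] \<in> J"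
    proof (rule two_sided_ideal_right[OF J(1)])
      show "x \<star> mon (path_word v (p @ [e])) \<in> J" using neg e by blast
      show "mon [Ghost e] \<in> F" using e by (simp add: mon_in_F)
    qed
    then show ?thesis
      by (simp add: conv_assoc fin monomial_conv path_word_def)
  qed
  then have "(\<lambda>w. \<Sum>e\<in>out_arcs E u. (x \<star> mon (?w @ [Edge e, Ghost e])) w) \<in> J"
    by (rule two_sided_ideal_sum[OF J(1)])
  then have sum: "x \<star> (mon ?w \<star> (\<lambda>w. \<Sum>e\<in>out_arcs E u. mon [Edge e, Ghost e] w)) \<in> J"
    by (simp add: conv_sum_right monomial_conv)
  have "mon ?w \<star> (mon [Vertex u] - (\<lambda>w. \<Sum>e\<in>out_arcs E u. mon [Edge e, Ghost e] w)) \<in> R"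
    using w by (intro two_sided_ideal_left[OF R_two_sided] vertex_eq_sum uE u) (simp add: mon_in_F path_word_def)
  then have "x \<star> (mon ?w \<star> (mon [Vertex u] - (\<lambda>w. \<Sum>e\<in>out_arcs E u. mon [Edge e, Ghost e] w))) \<in> R"
    by (rule two_sided_ideal_left[OF R_two_sided _ x])
  then have "x \<star> mon (?w @ [Vertex u]) \<in> J"
    using cong_mem[OF J] sum by (simp add: conv_diff_right monomial_conv)
  moreover have "x \<star> mon (?w @ [Vertex u]) - x \<star> mon ?w \<in> R"
    using two_sided_ideal_left[OF R_two_sided w_last x] by (simp add: conv_diff_right)
  ultimately show False using cong_mem[OF J] p(2) by blast
qed

lemma extend_path_long:
  assumes J: "two_sided_ideal (free_algebra K X) J" "R \<subseteq> J" and x: "x \<in> F"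
    and p: "awalk v p u" "x \<star> mon (path_word v p) \<notin> J"
  shows "\<exists>q u'. awalk v q u' \<and> x \<star> mon (path_word v q) \<notin> J \<and> (n \<le> length q \<or> out_arcs E u' = {})"
proof (induction n)
  case 0
  then show ?case using p by blast
next
  case (Suc n)
  then obtain q u' where q: "awalk v q u'" "x \<star> mon (path_word v q) \<notin> J"
      and n: "n \<le> length q \<or> out_arcs E u' = {}" by blast
  show ?case
  proof (cases "out_arcs E u' = {}")
    case True
    then show ?thesis using q by blast
  next
    case False
    with extend_path[OF J x q] obtain e where e: "e \<in> out_arcs E u'"
      "x \<star> mon (path_word v (q @ [e])) \<notin> J" by blast
    moreover have "awalk v (q @ [e]) (head E e)"
      using q(1) e(1) by (auto simp: awalk_Cons_iff awalk_Nil_iff)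
    ultimately show ?thesis using n False by (intro exI[of _ "q @ [e]"] exI[of _ "head E e"]) auto
  qed
qed

lemma conv_monomial_cong:
  assumes fin: "finite {w. x w \<noteq> 0}"
    and c: "\<And>u. x u \<noteq> 0 \<Longrightarrow> mon (u @ q) - c u \<in> R"
  shows "x \<star> mon q - (\<lambda>w. \<Sum>u | x u \<noteq> 0. (x u \<bullet> c u) w) \<in> R"
proof -
  have "x \<star> mon q = (\<lambda>w. \<Sum>u | x u \<noteq> 0. (x u \<bullet> mon u) w) \<star> mon q"
    by (rule arg_cong[where f = "\<lambda>z. z \<star> mon q", OF decompose_monomials[OF fin]])
  also have "\<dots> = (\<lambda>w. \<Sum>u | x u \<noteq> 0. (x u \<bullet> mon (u @ q)) w)"
    by (simp only: conv_sum_left monomial_conv flip: scale_conv)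
  finally have "x \<star> mon q - (\<lambda>w. \<Sum>u | x u \<noteq> 0. (x u \<bullet> c u) w) =
      (\<lambda>w. \<Sum>u | x u \<noteq> 0. (x u \<bullet> (mon (u @ q) - c u)) w)"
    by (simp add: fun_eq_iff sum_subtractf algebra_simps)
  also have "\<dots> \<in> R"
    using c by (intro two_sided_ideal_sum[OF R_two_sided] R_scale) auto
  finally show ?thesis .
qed

text \<open>Vertices are local units: \<open>x\<close> is the sum of the products \<open>x v\<close> over the finitely many targets
  \<open>v\<close> of its words. Here \<open>part v\<close> collects the words of \<open>x\<close> with target \<open>v\<close>.\<close>

lemma exists_vertex_not_mem:
  assumes J: "two_sided_ideal (free_algebra K X) J" "R \<subseteq> J" and x: "x \<in> F" "x \<notin> J"
  shows "\<exists>v\<in>verts E. x \<star> mon [Vertex v] \<notin> J"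
proof (rule ccontr)
  assume neg: "\<not> ?thesis"
  have fin: "finite {w. x w \<noteq> 0}" using x(1) by (rule free_carrier_finite)
  have supp: "w \<noteq> [] \<and> set w \<subseteq> X" if "x w \<noteq> 0" for w using x(1) that by (auto simp: free_carrier_def)
  define V where "V = (\<lambda>w. target (last w)) ` {w. x w \<noteq> 0}"
  define part where "part v w = (if target (last w) = v then x w else 0)" for v w
  have "part v \<in> J" if v: "v \<in> verts E" for v
  proof -
    define c where "c u = (if target (last u) = v then mon u else 0)" for u
    have "x \<star> mon [Vertex v] - (\<lambda>w. \<Sum>u | x u \<noteq> 0. (x u \<bullet> c u) w) \<in> R"
    proof (rule conv_monomial_cong[OF fin])
      fix u assume "x u \<noteq> 0"
      then have u: "u = butlast u @ [last u]" "set (butlast u) \<subseteq> X" "last u \<in> X"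
        using supp[of u] by (auto dest: in_set_butlastD)
      show "mon (u @ [Vertex v]) - c u \<in> R"
      proof (cases "target (last u) = v")
        case True
        then show ?thesis
          using word_cong[OF mult_target[OF u(3)] u(2), of "[]"] u(1)
          by (simp add: c_def) (metis append.assoc append_Cons append_Nil)
      next
        case False
        then show ?thesis
          using word_zero[OF mult_wrong_target[OF u(3) v] u(2), of "[]"] u(1)
          by (simp add: c_def) (metis append.assoc append_Cons append_Nil)
      qed
    qed
    moreover have "(\<lambda>w. \<Sum>u | x u \<noteq> 0. (x u \<bullet> c u) w) = part v"
    proof
      fix w
      have "(\<Sum>u | x u \<noteq> 0. (x u \<bullet> c u) w) = (\<Sum>u | x u \<noteq> 0. if u = w then part v u else 0)"
        by (intro sum.cong) (auto simp: c_def part_def monomial_def)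
      then show "(\<Sum>u | x u \<noteq> 0. (x u \<bullet> c u) w) = part v w"
        using fin by (simp add: part_def)
    qed
    ultimately have "x \<star> mon [Vertex v] - part v \<in> R" by simp
    then show ?thesis using cong_mem[OF J] neg v by blast
  qed
  moreover have "V \<subseteq> verts E" using supp target_in_verts by (auto simp: V_def subset_iff)
  ultimately have "(\<lambda>w. \<Sum>v\<in>V. part v w) \<in> J"
    by (intro two_sided_ideal_sum[OF J(1)]) auto
  moreover have "(\<lambda>w. \<Sum>v\<in>V. part v w) = x"
  proof
    fix w
    have "finite V" using fin by (simp add: V_def)
    then show "(\<Sum>v\<in>V. part v w) = x w" by (auto simp: part_def V_def)
  qed
  ultimately show False using x by simp
qed

lemma exists_long_path_not_mem:
  assumes J: "two_sided_ideal (free_algebra K X) J" "R \<subseteq> J" and x: "x \<in> F" "x \<notin> J"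
  shows "\<exists>v p u. awalk v p u \<and> x \<star> mon (path_word v p) \<notin> J \<and>
    (\<forall>w. x w \<noteq> 0 \<longrightarrow> length w \<le> length p \<or> out_arcs E u = {})"
proof -
  obtain v where v: "v \<in> verts E" "x \<star> mon [Vertex v] \<notin> J"
    using exists_vertex_not_mem[OF J x] by blast
  have fin: "finite (length ` {w. x w \<noteq> 0})" using free_carrier_finite[OF x(1)] by simp
  then obtain n where n: "\<And>w. x w \<noteq> 0 \<Longrightarrow> length w \<le> n"
    using Max_ge[OF fin] by blast
  have "awalk v [] v" "x \<star> mon (path_word v []) \<notin> J" using v by (auto simp: awalk_Nil_iff path_word_def)
  from extend_path_long[OF J x(1) this, of n] show ?thesis using n by (meson order_trans)
qed

text \<open>A path that is longer than all words of \<open>x\<close>, or ends in a sink, removes all ghosts of \<open>x\<close>.\<close>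

lemma exists_ghost_free_multiple_not_mem:
  assumes J: "two_sided_ideal (free_algebra K X) J" "R \<subseteq> J" and x: "x \<in> F" "x \<notin> J"
  shows "\<exists>v p u y. awalk v p u \<and> x \<star> mon (path_word v p) \<notin> J \<and> x \<star> mon (path_word v p) - y \<in> R \<and>
    (\<forall>w. y w \<noteq> 0 \<longrightarrow> (\<exists>v' p'. awalk v' p' u \<and> w = path_word v' p'))"
proof -
  obtain v p u where p: "awalk v p u" "x \<star> mon (path_word v p) \<notin> J"
    and long: "\<And>w. x w \<noteq> 0 \<Longrightarrow> length w \<le> length p \<or> out_arcs E u = {}"
    using exists_long_path_not_mem[OF J x] by blast
  have supp: "set w \<subseteq> X" if "x w \<noteq> 0" for w using x(1) that by (auto simp: free_carrier_def)
  have "\<exists>c. mon (w @ path_word v p) - c \<in> R \<and>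
      (\<forall>w'. c w' \<noteq> 0 \<longrightarrow> (\<exists>v' p'. awalk v' p' u \<and> w' = path_word v' p'))" if w: "x w \<noteq> 0" for w
  proof -
    from word_times_path[OF p(1) supp[OF w], of 0] long[OF w]
    consider "mon (w @ path_word v p) \<in> R" 
      | v' p' where "awalk v' p' u" "mon (w @ path_word v p) - mon (path_word v' p') \<in> R" by auto
    then show ?thesis
    proof cases
      case 1
      then show ?thesis by (intro exI[of _ 0]) auto
    next
      case 2
      then show ?thesis by (intro exI[of _ "mon (path_word v' p')"]) (auto simp: monomial_def)
    qed
  qed
  then obtain c where c: "\<And>w. x w \<noteq> 0 \<Longrightarrow> mon (w @ path_word v p) - c w \<in> R"
    "\<And>w w'. x w \<noteq> 0 \<Longrightarrow> c w w' \<noteq> 0 \<Longrightarrow> \<exists>v' p'. awalk v' p' u \<and> w' = path_word v' p'"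
    by metis
  define y where "y = (\<lambda>w. \<Sum>w' | x w' \<noteq> 0. (x w' \<bullet> c w') w)"
  have "x \<star> mon (path_word v p) - y \<in> R"
    unfolding y_def by (rule conv_monomial_cong[OF free_carrier_finite[OF x(1)] c(1)])
  moreover have "\<exists>v' p'. awalk v' p' u \<and> w = path_word v' p'" if "y w \<noteq> 0" for w
  proof -
    from that obtain w' where "x w' \<noteq> 0" "(x w' \<bullet> c w') w \<noteq> 0"
      unfolding y_def by (rule sum.not_neutral_contains_not_neutral) auto
    then show ?thesis using c(2)[of w' w] by simp
  qed
  ultimately show ?thesis using p by blast
qed

section \<open>A graded representation\<close>

text \<open>A point is a triple \<open>(v, d, m)\<close> with \<open>v\<close> outside \<open>H\<close>. Generators act from the right, so that a
  word is read from left to right. The number \<open>m\<close> plays the role of an infinite path starting at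
  \<open>v\<close>: if \<open>v\<close> emits edges that avoid \<open>H\<close>, then \<open>m\<close> codes a pair of such an edge and a number, through
  a bijection between the natural numbers and the countable set \<open>addresses v\<close>. An edge strips itself
  off, its ghost puts it back. Only at a vertex without such edges is \<open>m\<close> a mere label.
  The integer \<open>d\<close> counts edges minus ghosts.\<close>

definition kept_arcs :: "'v \<Rightarrow> 'e set" where
  "kept_arcs v = {e \<in> out_arcs E v. head E e \<notin> H}"

abbreviation "addresses v \<equiv> kept_arcs v \<times> (UNIV :: nat set)"

lemma countable_addresses: "countable (addresses v)"
proof -
  have "countable (kept_arcs v)"
    by (rule countable_subset[OF _ countable_arcs]) (auto simp: kept_arcs_def)
  then show ?thesis by simp
qed

lemma infinite_addresses: "kept_arcs v \<noteq> {} \<Longrightarrow> infinite (addresses v)"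
  by (auto simp: finite_cartesian_product_iff)

fun step :: "('v, 'e) generator \<Rightarrow> 'v \<times> int \<times> nat \<Rightarrow> ('v \<times> int \<times> nat) option" where
  "step (Vertex v) (u, d, m) = (if u = v \<and> v \<in> verts E - H then Some (u, d, m) else None)"
| "step (Edge e) (u, d, m) =
     (if e \<in> kept_arcs u \<and> fst (from_nat_into (addresses u) m) = e
      then Some (head E e, d + 1, snd (from_nat_into (addresses u) m)) else None)"
| "step (Ghost e) (u, d, m) =
     (if e \<in> arcs E \<and> u = head E e \<and> u \<notin> H
      then Some (tail E e, d - 1, to_nat_on (addresses (tail E e)) (e, m)) else None)"

fun run :: "('v, 'e) generator list \<Rightarrow> 'v \<times> int \<times> nat \<Rightarrow> ('v \<times> int \<times> nat) option" where
  "run [] x = Some x"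
| "run (g # w) x = Option.bind (step g x) (run w)"

lemma run_append: "run (u @ v) x = Option.bind (run u x) (run v)"
  by (induction u arbitrary: x) (auto split: bind_splits)

definition value_at :: "('x \<Rightarrow> 'k) \<Rightarrow> 'x option \<Rightarrow> 'k" where
  "value_at \<phi> z = (case z of None \<Rightarrow> 0 | Some y \<Rightarrow> \<phi> y)"

lemma value_at_simps [simp]: "value_at \<phi> None = 0" "value_at \<phi> (Some y) = \<phi> y"
  by (simp_all add: value_at_def)

text \<open>The partial maps act on functions on the points, with value \<open>0\<close> where a map is undefined. This
  turns concatenation into composition of operators, hence \<open>\<star>\<close> too (\<open>act_conv\<close>).\<close>

definition act :: "(('v, 'e) generator list \<Rightarrow> 'k) \<Rightarrow> ('v \<times> int \<times> nat \<Rightarrow> 'k) \<Rightarrow> 'v \<times> int \<times> nat \<Rightarrow> 'k" where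
  "act a \<phi> x = lin (\<lambda>w. value_at \<phi> (run w x)) a"

lemma act_mon [simp]: "act (mon w) \<phi> x = value_at \<phi> (run w x)"
  by (simp add: act_def)

lemma act_zero [simp]: "act (\<lambda>_. 0) \<phi> x = 0"
  by (simp add: act_def lin_def)

lemma act_conv:
  assumes "a \<in> F" "b \<in> F"
  shows "act (a \<star> b) \<phi> x = act a (act b \<phi>) x"
proof -
  have "lin (\<lambda>v. value_at \<phi> (run (u @ v) x)) b = value_at (act b \<phi>) (run u x)" for u
    by (cases "run u x") (simp_all add: run_append act_def)
  then show ?thesis
    unfolding act_def[of "a \<star> b"] act_def[of a]
    using assms[THEN free_carrier_finite] by (simp add: lin_conv)
qed

lemma act_zero_fun: "act a (\<lambda>_. 0) x = 0"
proof -
  have "value_at (\<lambda>_. 0) z = 0" for z :: "('v \<times> int \<times> nat) option" by (cases z) auto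
  then show ?thesis by (simp add: act_def)
qed

definition annihilator :: "(('v, 'e) generator list \<Rightarrow> 'k) set" where
  "annihilator = {a \<in> F. \<forall>\<phi> x. act a \<phi> x = 0}"

lemma annihilator_algebra_ideal: "algebra_ideal (free_algebra K X) annihilator"
  unfolding algebra_ideal_free_algebra_iff two_sided_ideal_free_algebra_iff
proof (intro conjI ballI allI)
  show "annihilator \<subseteq> F" by (auto simp: annihilator_def)
  show "0 \<in> annihilator" by (simp add: annihilator_def act_def)
  fix a assume a: "a \<in> annihilator"
  show "a - b \<in> annihilator" if "b \<in> annihilator" for b
    using a that by (auto simp: annihilator_def act_def lin_diff free_carrier_finite free_carrier_diff)
  show "c \<bullet> a \<in> annihilator" for c
    using a by (auto simp: annihilator_def act_def lin_scale free_carrier_scale)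
  fix x assume x: "x \<in> F"
  have aF: "a \<in> F" and "act a = (\<lambda>\<phi> x. 0)"
    using a by (auto simp: annihilator_def fun_eq_iff)
  then show "x \<star> a \<in> annihilator" "a \<star> x \<in> annihilator"
    using x by (auto simp: annihilator_def act_conv act_zero_fun free_carrier_conv)
qed

lemma hereditary_head: "e \<in> arcs E \<Longrightarrow> head E e \<notin> H \<Longrightarrow> tail E e \<in> verts E - H"
  using hered arc_implies_awalk[of e] unfolding hereditary_def connects_def by auto

text \<open>This is where saturation enters: the edges into \<open>H\<close> act as zero, so the edges out of \<open>v\<close> that
  avoid \<open>H\<close> alone must account for \<open>v = (\<Sum>s(e)=v. e e\<^sup>*)\<close>.\<close>

lemma kept_arcs_nonempty:
  assumes "v \<in> verts E - H" "out_arcs E v \<noteq> {}"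
  shows "kept_arcs v \<noteq> {}"
  using sat assms unfolding saturated_def kept_arcs_def by blast

lemma step_ghost_edge:
  assumes e: "e \<in> arcs E" "head E e \<notin> H"
  shows "step (Ghost e) (head E e, d, m) = Some (tail E e, d - 1, to_nat_on (addresses (tail E e)) (e, m))"
    and "step (Edge f) (tail E e, d - 1, to_nat_on (addresses (tail E e)) (e, m)) =
      (if f = e then Some (head E e, d, m) else None)"
proof -
  have "e \<in> kept_arcs (tail E e)" using e by (auto simp: kept_arcs_def)
  then have "from_nat_into (addresses (tail E e)) (to_nat_on (addresses (tail E e)) (e, m)) = (e, m)"
    by (intro from_nat_into_to_nat_on countable_addresses) auto
  then show "step (Edge f) (tail E e, d - 1, to_nat_on (addresses (tail E e)) (e, m)) =
      (if f = e then Some (head E e, d, m) else None)"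
    using \<open>e \<in> kept_arcs (tail E e)\<close> by auto
qed (use e in simp)

text \<open>Stripping an edge and putting it back is defined for exactly one edge, the one coded by \<open>m\<close>;
  therefore the sum of the \<open>e e\<^sup>*\<close> acts as the vertex.\<close>

lemma run_edge_ghost:
  assumes "kept_arcs u \<noteq> {}"
  shows "run [Edge e, Ghost e] (u, d, m) =
    (if e = fst (from_nat_into (addresses u) m) then Some (u, d, m) else None)"
proof -
  obtain f n where fn: "from_nat_into (addresses u) m = (f, n)" by fastforce
  have "(f, n) \<in> addresses u" using from_nat_into[of "addresses u" m] assms fn by auto
  then have f: "f \<in> kept_arcs u" by simp
  then have f': "f \<in> arcs E" "tail E f = u" "head E f \<notin> H" by (auto simp: kept_arcs_def)
  have "to_nat_on (addresses u) (f, n) = m"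
    using to_nat_on_from_nat_into_infinite[OF countable_addresses infinite_addresses[OF assms], of m] fn by simp
  then show ?thesis using fn f f' by auto
qed

lemma relation_in_annihilator:
  assumes "(a, b) \<in> leavitt_relations E"
  shows "a - b \<in> annihilator"
proof -
  have "a - b \<in> F"
    using assms leavitt_relators_subset by (auto simp: leavitt_relators_eq)
  moreover have "finite {w. a w \<noteq> 0} \<and> finite {w. b w \<noteq> 0} \<and> (\<forall>\<phi> x. act a \<phi> x = act b \<phi> x)"
    using assms
  proof induction
    case (vertex_sum v)
    let ?b = "\<lambda>w. \<Sum>e\<in>out_arcs E v. mon [Edge e, Ghost e] w"
    have fin: "finite (out_arcs E v)" using row_finite[OF vertex_sum(1)] .
    have "?b \<in> F"
      by (auto simp: mon_in_F intro!: two_sided_ideal_sum[OF two_sided_ideal_free_carrier])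
    moreover have "act (mon [Vertex v]) \<phi> x = act ?b \<phi> x" for \<phi> x
    proof -
      obtain u d m where x: "x = (u, d, m)" by (cases x)
      have "act ?b \<phi> x = (\<Sum>e\<in>out_arcs E v. value_at \<phi> (run [Edge e, Ghost e] x))"
        unfolding act_def by (subst lin_sum[OF fin]) simp_all
      also have "\<dots> = act (mon [Vertex v]) \<phi> x"
      proof (cases "u = v \<and> v \<notin> H")
        case True
        then have ne: "kept_arcs u \<noteq> {}" using kept_arcs_nonempty vertex_sum by auto
        have "fst (from_nat_into (addresses u) m) \<in> kept_arcs u"
          using from_nat_into[of "addresses u" m] ne by (metis Times_empty UNIV_not_empty mem_Times_iff)
        then have "fst (from_nat_into (addresses u) m) \<in> out_arcs E v"
          using True by (simp add: kept_arcs_def)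
        moreover have "value_at \<phi> (run [Edge e, Ghost e] x) =
            (if e = fst (from_nat_into (addresses u) m) then \<phi> x else 0)" for e
          unfolding x run_edge_ghost[OF ne] by simp
        ultimately show ?thesis
          using True vertex_sum fin x by simp
      next
        case False
        have "run [Edge e, Ghost e] x = None" if "e \<in> out_arcs E v" for e
          using False that hereditary_head[of e] x by (auto simp: kept_arcs_def split: bind_splits)
        then show ?thesis using False x by auto
      qed
      finally show ?thesis ..
    qed
    ultimately show ?case using free_carrier_finite by auto
  next
    case (ghost_edge_same e)
    have "run [Ghost e, Edge e] x = run [Vertex (head E e)] x" for x
    proof (cases x)
      case (fields u d m)
      show ?thesis
      proof (cases "u = head E e \<and> u \<notin> H")
        case True
        then have h: "head E e \<notin> H" by blast
        show ?thesis using True ghost_edge_same h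
          by (simp add: fields step_ghost_edge[OF ghost_edge_same h] del: step.simps(2,3))
      qed (auto simp: fields)
    qed
    then show ?case by simp
  next
    case (ghost_edge_diff e f)
    have "run [Ghost e, Edge f] x = None" for x
    proof (cases x)
      case (fields u d m)
      show ?thesis
      proof (cases "u = head E e \<and> u \<notin> H")
        case True
        then have h: "head E e \<notin> H" by blast
        show ?thesis using True ghost_edge_diff
          by (simp add: fields step_ghost_edge[OF ghost_edge_diff(1) h] del: step.simps)
      qed (auto simp: fields)
    qed
    then show ?case by simp
  next
    case (vertex_orth v w)
    have "run [Vertex v, Vertex w] x = None" for x
      using vertex_orth by (cases x) auto
    then show ?case by simp
  next
    case (vertex_idem v)
    have "run [Vertex v, Vertex v] x = run [Vertex v] x" for x by (cases x) auto
    then show ?case by simp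
  next
    case (source_edge e)
    have "run [Vertex (tail E e), Edge e] x = run [Edge e] x" for x
      using source_edge hereditary_head[of e] by (cases x) (auto simp: kept_arcs_def)
    then show ?case by simp
  next
    case (edge_range e)
    have "run [Edge e, Vertex (head E e)] x = run [Edge e] x" for x
      using edge_range by (cases x) (auto simp: kept_arcs_def)
    then show ?case by simp
  next
    case (range_ghost e)
    have "run [Vertex (head E e), Ghost e] x = run [Ghost e] x" for x
      using range_ghost by (cases x) auto
    then show ?case by simp
  next
    case (ghost_source e)
    have "run [Ghost e, Vertex (tail E e)] x = run [Ghost e] x" for x
      using ghost_source hereditary_head[of e] by (cases x) auto
    then show ?case by simp
  qed
  ultimately show ?thesis by (simp add: annihilator_def act_def lin_diff)
qed

lemma vertex_preideal_subset_annihilator: "vertex_preideal \<subseteq> annihilator"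
proof (rule vertex_preideal_minimal)
  show "two_sided_ideal (free_algebra K X) annihilator"
    using annihilator_algebra_ideal by (simp add: algebra_ideal_free_algebra_iff)
  show "R \<subseteq> annihilator"
    by (rule R_minimal[OF annihilator_algebra_ideal relation_in_annihilator])
  show "mon [Vertex v] \<in> annihilator" if "v \<in> H" for v
    using that H_subset by (auto simp: annihilator_def mon_in_F)
qed

lemma vertex_in_preideal_iff:
  assumes "v \<in> verts E"
  shows "mon [Vertex v] \<in> vertex_preideal \<longleftrightarrow> v \<in> H"
proof
  assume "mon [Vertex v] \<in> vertex_preideal"
  then have "act (mon [Vertex v]) (\<lambda>_. 1) (v, 0, 0) = 0"
    using vertex_preideal_subset_annihilator unfolding annihilator_def by blast
  then show "v \<in> H" using assms by (auto split: if_splits)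
qed (rule vertex_in_preideal)

definition ghost_word :: "'v \<Rightarrow> 'e list \<Rightarrow> ('v, 'e) generator list" where
  "ghost_word v p = map Ghost (rev p) @ [Vertex v]"

lemma ghost_word_generators: "awalk v p u \<Longrightarrow> set (ghost_word v p) \<subseteq> X"
  by (auto simp: ghost_word_def awalk_def)

fun generator_degree :: "('v, 'e) generator \<Rightarrow> int" where
  "generator_degree (Vertex v) = 0" | "generator_degree (Edge e) = 1" | "generator_degree (Ghost e) = -1"

definition word_degree :: "('v, 'e) generator list \<Rightarrow> int" where
  "word_degree w = (\<Sum>g\<leftarrow>w. generator_degree g)"

lemma run_degree:
  assumes "run w x = Some y"
  shows "fst (snd y) = fst (snd x) + word_degree w"
  using assms
proof (induction w arbitrary: x)
  case (Cons g w)
  then obtain z where z: "step g x = Some z" "run w z = Some y"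
    by (cases "step g x") auto
  moreover have "fst (snd z) = fst (snd x) + generator_degree g"
    using z(1) by (cases x; cases g) (auto split: if_splits)
  ultimately show ?case using Cons.IH[OF z(2)] by (simp add: word_degree_def)
qed (simp add: word_degree_def)

lemma word_degree_append: "word_degree (w @ w') = word_degree w + word_degree w'"
  by (simp add: word_degree_def)

lemma word_degree_path_word: "word_degree (path_word v p) = int (length p)"
proof -
  have "word_degree (map Edge p) = int (length p)"
    by (induction p) (auto simp: word_degree_def)
  then show ?thesis by (simp add: word_degree_def path_word_def)
qed

lemma word_degree_ghost_word: "word_degree (ghost_word v p) = - int (length p)"
proof -
  have "word_degree (map Ghost (rev p)) = - int (length p)"
    by (induction p) (auto simp: word_degree_def)
  then show ?thesis by (simp add: word_degree_def ghost_word_def)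
qed

text \<open>A path that ends outside \<open>H\<close> can be put in front of any point above its end, and taken off
  again.\<close>

lemma run_ghost_path:
  assumes "awalk v p u" "u \<notin> H"
  shows "v \<notin> H \<and> (\<exists>y. run (map Ghost (rev p)) (u, d, m) = Some y \<and> fst y = v \<and>
    run (map Edge p) y = Some (u, d, m))"
  using assms
proof (induction p arbitrary: v)
  case Nil
  then show ?case by (auto simp: awalk_Nil_iff)
next
  case (Cons e p)
  then have e: "e \<in> arcs E" "v = tail E e" "awalk (head E e) p u" by (auto simp: awalk_Cons_iff)
  from Cons.IH[OF e(3) Cons.prems(2)] obtain d1 m1 where h: "head E e \<notin> H"
    and 1: "run (map Ghost (rev p)) (u, d, m) = Some (head E e, d1, m1)"
      "run (map Edge p) (head E e, d1, m1) = Some (u, d, m)" by force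
  show ?case
    using hereditary_head[OF e(1) h]
    by (simp add: run_append 1 e(2) step_ghost_edge[OF e(1) h] del: step.simps)
qed

text \<open>A point determines which edge can be stripped off next, hence the path of each length.\<close>

lemma run_edges_deterministic:
  assumes "run (map Edge p) x \<noteq> None" "run (map Edge q) x \<noteq> None" "length p = length q"
  shows "p = q"
  using assms
proof (induction p arbitrary: q x)
  case (Cons e p)
  then obtain f q' where q: "q = f # q'" by (cases q) auto
  have "e = f" 
    using Cons.prems q by (cases x) (auto split: if_splits)
  then show ?case using Cons.prems Cons.IH[of _ q'] q by (cases "step (Edge e) x") auto
qed simp

lemma run_path_word: "run (path_word v p) x =
    (if fst x = v \<and> v \<in> verts E - H then run (map Edge p) x else None)"
  by (cases x) (simp add: path_word_def)

lemma run_ghost_word: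
  assumes p: "awalk v p u" and x: "fst x = u" "u \<notin> H"
  shows "\<exists>y. run (ghost_word v p) x = Some y \<and> fst y = v \<and> run (path_word v p) y = Some x"
proof -
  obtain d m where xe: "x = (u, d, m)" using x by (cases x) auto
  from run_ghost_path[OF p x(2)] obtain y where "v \<notin> H" "run (map Ghost (rev p)) x = Some y" "fst y = v"
    "run (map Edge p) y = Some x" unfolding xe by blast
  moreover have "v \<in> verts E" using p by auto
  ultimately show ?thesis
    by (cases y) (auto simp: ghost_word_def run_append run_path_word)
qed

lemma run_path_word_deterministic:
  assumes "run (path_word v p) x \<noteq> None" "run (path_word v' p') x \<noteq> None" "length p = length p'"
  shows "path_word v p = path_word v' p'"
  using assms run_edges_deterministic[of p x p'] by (auto simp: run_path_word split: if_splits)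

section \<open>Primeness and maximal tails\<close>

text \<open>The coefficient of the product at a pair of points \<open>(x\<^sub>1, x\<^sub>3)\<close> is computed. The points are chosen
  so that the word coming from \<open>\<alpha>\<close> and \<open>\<alpha>'\<close> (here \<open>a\<close> and \<open>a'\<close>) leads from one to the other.
  Any other contributing word consists of paths at least as long; comparing degrees, they have the same
  lengths as \<open>a\<close> and \<open>a'\<close>, and two paths of equal length applicable at the same point agree.\<close>

lemma product_not_mem:
  assumes t: "t \<notin> H" and p: "awalk u p t" and p': "awalk u' p' t"
    and y: "y \<in> F" "\<And>w. y w \<noteq> 0 \<Longrightarrow> \<exists>v q. awalk v q u \<and> length a \<le> length q \<and> w = path_word v q"
    and a: "awalk v a u" "y (path_word v a) \<noteq> 0"
    and y': "y' \<in> F" "\<And>w. y' w \<noteq> 0 \<Longrightarrow> \<exists>v q. awalk v q u' \<and> length a' \<le> length q \<and> w = path_word v q"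
    and a': "awalk v' a' u'" "y' (path_word v' a') \<noteq> 0"
  shows "(mon (ghost_word v a) \<star> y) \<star>
    (mon (path_word u p @ ghost_word u' p' @ ghost_word v' a') \<star> y') \<notin> vertex_preideal"
    (is "?z \<notin> _")
proof
  let ?g = "path_word u p @ ghost_word u' p' @ ghost_word v' a'"
  assume "?z \<in> vertex_preideal"
  then have zero: "act ?z \<phi> x = 0" for \<phi> x
    using vertex_preideal_subset_annihilator unfolding annihilator_def by blast
  \<comment> \<open>\<open>x0\<close> is any point above \<open>t\<close>; putting paths in front of it, and on from there, gives the chain
    of points visited by the distinguished word.\<close>
  define x0 where "x0 = (t, 0 :: int, 0 :: nat)"
  obtain x1 where x1: "run (path_word u p) x1 = Some x0" "fst x1 = u"
    using run_ghost_word[OF p, of x0] t by (auto simp: x0_def)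
  have "u \<notin> H" using run_ghost_path[OF p t] by blast
  then obtain x2 where x2: "run (ghost_word v a) x1 = Some x2" "run (path_word v a) x2 = Some x1"
    using run_ghost_word[OF a(1) x1(2)] by blast
  obtain x3 where x3: "run (ghost_word u' p') x0 = Some x3" "fst x3 = u'"
    using run_ghost_word[OF p', of x0] t by (auto simp: x0_def)
  have "u' \<notin> H" using run_ghost_path[OF p' t] by blast
  then obtain x4 where x4: "run (ghost_word v' a') x3 = Some x4" "run (path_word v' a') x4 = Some x3"
    using run_ghost_word[OF a'(1) x3(2)] by blast
  define \<phi> :: "'v \<times> int \<times> nat \<Rightarrow> 'k" where "\<phi> x = (if x = x3 then 1 else 0)" for x
  have value_eq: "value_at \<phi> (run (ghost_word v a @ b @ ?g @ b') x1) =
      (if b = path_word v a then if b' = path_word v' a' then 1 else 0 else 0)"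
    if b: "y b \<noteq> 0" and b': "y' b' \<noteq> 0" for b b'
  proof (cases "run (ghost_word v a @ b @ ?g @ b') x1 = Some x3")
    case True
    obtain v2 q where q: "b = path_word v2 q" "length a \<le> length q" using y(2)[OF b] by blast
    obtain v2' q' where q': "b' = path_word v2' q'" "length a' \<le> length q'" using y'(2)[OF b'] by blast
    have "fst (snd x3) = fst (snd x0) + word_degree (ghost_word u' p')"
      "fst (snd x0) = fst (snd x1) + word_degree (path_word u p)"
      "fst (snd x3) = fst (snd x1) + word_degree (ghost_word v a @ b @ ?g @ b')"
      using run_degree[OF x3(1)] run_degree[OF x1(1)] run_degree[OF True] by simp_all
    then have len: "length a = length q" "length a' = length q'"
      using q q' by (auto simp: word_degree_append word_degree_path_word word_degree_ghost_word)
    have run_b: "Option.bind (run b x2) (run (?g @ b')) = Some x3"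
      using True x2(1) by (simp add: run_append)
    then have "run (path_word v2 q) x2 \<noteq> None" using q(1) by (cases "run b x2") auto
    then have b_eq: "b = path_word v a"
      using run_path_word_deterministic[of v a x2 v2 q] x2(2) len q(1) by simp
    then have "run b' x4 = Some x3"
      using run_b x2(2) x1(1) x3(1) x4(1) by (simp add: run_append)
    then have "b' = path_word v' a'"
      using run_path_word_deterministic[of v' a' x4 v2' q'] x4(2) len q'(1) by simp
    then show ?thesis using True b_eq by (simp add: \<phi>_def)
  next
    case False
    then have "\<not> (b = path_word v a \<and> b' = path_word v' a')"
      using x1(1) x2 x3(1) x4 by (auto simp: run_append)
    moreover have "value_at \<phi> (run (ghost_word v a @ b @ ?g @ b') x1) = 0"
      using False by (cases "run (ghost_word v a @ b @ ?g @ b') x1") (auto simp: \<phi>_def)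
    ultimately show ?thesis by auto
  qed
  have fin: "finite {w. y w \<noteq> 0}" "finite {w. y' w \<noteq> 0}"
    using y(1) y'(1) by (auto intro: free_carrier_finite)
  have "act ?z \<phi> x1 = lin (\<lambda>b. lin (\<lambda>b'. value_at \<phi> (run (ghost_word v a @ b @ ?g @ b') x1)) y') y"
    unfolding act_def by (simp add: lin_conv fin finite_conv_support)
  also have "\<dots> = lin (\<lambda>b. lin (\<lambda>b'. if b = path_word v a then if b' = path_word v' a' then 1 else 0 else 0) y') y"
    unfolding lin_def by (intro sum.cong refl arg_cong2[where f = "(*)"] value_eq) simp_all
  also have "\<dots> = lin (\<lambda>b. if b = path_word v a then y' (path_word v' a') else 0) y"
  proof -
    have "lin (\<lambda>b'. if b = path_word v a then if b' = path_word v' a' then 1 else 0 else 0) y' =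
      (if b = path_word v a then y' (path_word v' a') else 0)" for b
      using lin_indicator[OF fin(2)] by simp
    then show ?thesis by simp
  qed
  also have "\<dots> = y (path_word v a) * y' (path_word v' a')"
  proof -
    have "lin (\<lambda>b. if b = path_word v a then y' (path_word v' a') else 0) y =
        lin (\<lambda>b. if b = path_word v a then 1 else 0) y * y' (path_word v' a')"
      unfolding lin_def sum_distrib_right by (intro sum.cong) auto
    then show ?thesis using lin_indicator[OF fin(1)] by simp
  qed
  finally show False using zero a(2) a'(2) by simp
qed

text \<open>The reduction to paths changes elements by members of \<open>R\<close> and therefore stays inside \<open>A\<close>;
  changes by members of \<open>vertex_preideal\<close> could lead out of \<open>A\<close>. The path \<open>a\<close> is a shortest one in \<open>y\<close>,
  so that multiplying by its ghosts on the left leaves no words of negative degree.\<close>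

lemma ideal_contains_ghost_free_element:
  assumes A: "two_sided_ideal (free_algebra K X) A" "R \<subseteq> A" "\<not> A \<subseteq> vertex_preideal"
  shows "\<exists>y u v a. y \<in> A \<and> u \<in> verts E - H \<and> awalk v a u \<and> y (path_word v a) \<noteq> 0 \<and>
    (\<forall>w. y w \<noteq> 0 \<longrightarrow> (\<exists>v q. awalk v q u \<and> length a \<le> length q \<and> w = path_word v q))"
proof -
  note I = vertex_preideal_two_sided R_subset_vertex_preideal
  obtain x where x: "x \<in> A" "x \<notin> vertex_preideal" using A(3) by blast
  then have xF: "x \<in> F" using two_sided_ideal_subset[OF A(1)] by blast
  from exists_ghost_free_multiple_not_mem[OF I xF x(2)] obtain v p u y where p: "awalk v p u"
    and xp: "x \<star> mon (path_word v p) \<notin> vertex_preideal" "x \<star> mon (path_word v p) - y \<in> R"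
    and y: "\<And>w. y w \<noteq> 0 \<Longrightarrow> \<exists>v' p'. awalk v' p' u \<and> w = path_word v' p'"
    by blast
  have "x \<star> mon (path_word v p) \<in> A"
    using x(1) path_word_generators[OF p]
    by (intro two_sided_ideal_right[OF A(1)]) (auto simp: mon_in_F path_word_def)
  then have yA: "y \<in> A" using cong_mem[OF A(1,2) xp(2)] by blast
  have y_notin: "y \<notin> vertex_preideal" using cong_mem[OF I xp(2)] xp(1) by blast
  have "u \<notin> H"
  proof
    assume "u \<in> H"
    then have "mon (path_word v p) \<in> vertex_preideal" using path_word_in_preideal[OF p] by blast
    then show False using xp(1) two_sided_ideal_left[OF I(1) _ xF] by blast
  qed
  have "\<exists>w. y w \<noteq> 0" 
  proof (rule ccontr)
    assume "\<nexists>w. y w \<noteq> 0"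
    then have "y = 0" by (auto simp: fun_eq_iff)
    then show False using y_notin two_sided_ideal_zero[OF I(1)] by simp
  qed
  then have "\<exists>n v a. n = length a \<and> awalk v a u \<and> y (path_word v a) \<noteq> 0" using y by blast
  from LeastI_ex[OF this] Least_le[of "\<lambda>n. \<exists>v a. n = length a \<and> awalk v a u \<and> y (path_word v a) \<noteq> 0"]
  obtain v a where a: "awalk v a u" "y (path_word v a) \<noteq> 0"
    and least: "\<And>v' a'. awalk v' a' u \<Longrightarrow> y (path_word v' a') \<noteq> 0 \<Longrightarrow> length a \<le> length a'"
    by metis
  have "\<exists>v q. awalk v q u \<and> length a \<le> length q \<and> w = path_word v q" if "y w \<noteq> 0" for w
    using y[OF that] least that by blast
  moreover have "u \<in> verts E" using p by auto
  ultimately show ?thesis using yA \<open>u \<notin> H\<close> a by blast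
qed

lemma prime_if_maximal_tail:
  assumes M: "maximal_tail E (verts E - H)"
  shows "prime_ideal (leavitt_path_algebra K E) (vertex_ideal K E H)"
  unfolding prime_vertex_ideal_iff
proof (intro conjI allI impI)
  from M obtain v where "v \<in> verts E" "v \<notin> H" by (auto simp: maximal_tail_def)
  then show "vertex_preideal \<noteq> F" using vertex_in_preideal_iff[of v] by (auto simp: mon_in_F)
next
  fix A B
  assume asm: "two_sided_ideal (free_algebra K X) A \<and> two_sided_ideal (free_algebra K X) B \<and>
    R \<subseteq> A \<and> R \<subseteq> B \<and> (\<forall>a\<in>A. \<forall>b\<in>B. a \<star> b \<in> vertex_preideal)"
  then have A: "two_sided_ideal (free_algebra K X) A" and B: "two_sided_ideal (free_algebra K X) B"
    and R: "R \<subseteq> A" "R \<subseteq> B" and prod: "\<forall>a\<in>A. \<forall>b\<in>B. a \<star> b \<in> vertex_preideal"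
    by simp_all
  show "A \<subseteq> vertex_preideal \<or> B \<subseteq> vertex_preideal"
  proof (rule ccontr)
    assume neg: "\<not> ?thesis"
    then obtain y u v a where y: "y \<in> A" "u \<in> verts E - H" "awalk v a u" "y (path_word v a) \<noteq> 0"
      "\<And>w. y w \<noteq> 0 \<Longrightarrow> \<exists>v q. awalk v q u \<and> length a \<le> length q \<and> w = path_word v q"
      using ideal_contains_ghost_free_element[OF A R(1)] by metis
    obtain y' u' v' a' where y': "y' \<in> B" "u' \<in> verts E - H" "awalk v' a' u'" "y' (path_word v' a') \<noteq> 0"
      "\<And>w. y' w \<noteq> 0 \<Longrightarrow> \<exists>v q. awalk v q u' \<and> length a' \<le> length q \<and> w = path_word v q"
      using ideal_contains_ghost_free_element[OF B R(2)] neg by metis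
    from M y(2) y'(2) obtain t p p' where t: "t \<notin> H" "awalk u p t" "awalk u' p' t"
      unfolding maximal_tail_def connects_def by (metis DiffD2)
    have yF: "y \<in> F" "y' \<in> F" using y(1) y'(1) A B two_sided_ideal_subset by blast+
    have "mon (ghost_word v a) \<star> y \<in> A"
      using ghost_word_generators[OF y(3)]
      by (intro two_sided_ideal_left[OF A y(1)]) (auto simp: mon_in_F ghost_word_def)
    moreover have "mon (path_word u p @ ghost_word u' p' @ ghost_word v' a') \<star> y' \<in> B"
      using path_word_generators[OF t(2)] ghost_word_generators[OF t(3)] ghost_word_generators[OF y'(3)]
      by (intro two_sided_ideal_left[OF B y'(1)]) (auto simp: mon_in_F ghost_word_def)
    ultimately show False
      using product_not_mem[OF t yF(1) y(5) y(3,4) yF(2) y'(5) y'(3,4)] prod by blast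
  qed
qed

text \<open>Multiplying \<open>v g w\<close> by a long path from \<open>s\<close> to \<open>u\<close> gives a path from \<open>s'\<close> to \<open>u\<close>. As the result is
  nonzero modulo \<open>I(H)\<close>, the outer vertices agree: \<open>s = w\<close> and \<open>s' = v\<close>.\<close>

lemma common_successor:
  assumes v: "v \<in> verts E" and w: "w \<in> verts E"
    and g: "set g \<subseteq> X" "mon (Vertex v # g @ [Vertex w]) \<notin> vertex_preideal"
  shows "\<exists>y\<in>verts E - H. connects E v y \<and> connects E w y"
proof -
  note I = vertex_preideal_two_sided R_subset_vertex_preideal
  let ?g = "Vertex v # g @ [Vertex w]"
  have gX: "set ?g \<subseteq> X" using v w g by simp
  then have gF: "mon ?g \<in> F" by (simp add: mon_in_F)
  obtain s p u where p: "awalk s p u" and gp: "mon ?g \<star> mon (path_word s p) \<notin> vertex_preideal"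
    and long: "length ?g \<le> length p \<or> out_arcs E u = {}"
  proof -
    have "mon ?g ?g \<noteq> 0" by (simp add: monomial_def)
    then show ?thesis using exists_long_path_not_mem[OF I gF g(2)] that by blast
  qed
  have gp_notin: "mon (?g @ path_word s p) \<notin> vertex_preideal" using gp by (simp add: monomial_conv)
  have "w = s"
  proof (rule ccontr)
    assume "w \<noteq> s"
    then have "mon [Vertex w, Vertex s] \<in> R"
      using w p by (intro relation_zero_in_R leavitt_relations.vertex_orth) auto
    from word_zero[OF this, of "Vertex v # g" "map Edge p"]
    have "mon (?g @ path_word s p) \<in> R" using gX tl_path_word_generators[OF p] by (simp add: path_word_def)
    then show False using gp_notin I(2) by blast
  qed
  from word_times_path[OF p gX, of 0] long obtain s' p' where p': "awalk s' p' u"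
    and eq: "mon (?g @ path_word s p) - mon (path_word s' p') \<in> R"
    using gp_notin I(2) by auto
  have p'_notin: "mon (path_word s' p') \<notin> vertex_preideal" using cong_mem[OF I eq] gp_notin by blast
  have "v = s'"
  proof (rule ccontr)
    assume "v \<noteq> s'"
    then have "mon [Vertex v, Vertex s'] \<in> R"
      using v p' by (intro relation_zero_in_R leavitt_relations.vertex_orth) auto
    from word_zero[OF this, of "[]" "map Edge p'"]
    have "mon (Vertex v # path_word s' p') \<in> R" using tl_path_word_generators[OF p'] by (simp add: path_word_def)
    moreover have "mon (Vertex v # ?g @ path_word s p) - mon (Vertex v # path_word s' p') \<in> R"
      using word_cong[OF eq, of "[Vertex v]" "[]"] v by simp
    moreover have "mon (Vertex v # ?g @ path_word s p) - mon (?g @ path_word s p) \<in> R"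
      using word_cong[OF relation_in_R[OF leavitt_relations.vertex_idem[OF v]], of "[]" "g @ [Vertex w] @ path_word s p"]
        gX path_word_generators[OF p] by simp
    ultimately have "mon (?g @ path_word s p) \<in> R" using cong_zero by blast
    then show False using gp_notin I(2) by blast
  qed
  moreover have "u \<notin> H" using path_word_in_preideal[OF p'] p'_notin by blast
  moreover have "u \<in> verts E" using p by auto
  ultimately show ?thesis using p p' \<open>w = s\<close> unfolding connects_def by blast
qed

lemma maximal_tail_if_prime:
  assumes prime: "prime_ideal (leavitt_path_algebra K E) (vertex_ideal K E H)"
  shows "maximal_tail E (verts E - H)"
  unfolding maximal_tail_def
proof (intro conjI ballI impI)
  note I = vertex_preideal_two_sided R_subset_vertex_preideal
  note P = prime[unfolded prime_vertex_ideal_iff]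
  obtain x where "x \<in> F" "x \<notin> vertex_preideal"
    using P two_sided_ideal_subset[OF I(1)] by blast
  from exists_vertex_not_mem[OF I this] obtain v where "v \<in> verts E" "x \<star> mon [Vertex v] \<notin> vertex_preideal"
    by blast
  then have "v \<notin> H"
    using two_sided_ideal_left[OF I(1) vertex_in_preideal \<open>x \<in> F\<close>] by blast
  then show "verts E - H \<noteq> {}" using \<open>v \<in> verts E\<close> by blast
  show "verts E - H \<subseteq> verts E" by blast
  show "v \<in> verts E - H" if "v \<in> verts E" "w \<in> verts E - H" "connects E v w" for v w
    using that hered unfolding hereditary_def by blast
  show "\<exists>e\<in>out_arcs E v. head E e \<in> verts E - H" if "v \<in> verts E - H" "out_arcs E v \<noteq> {}" for v
    using kept_arcs_nonempty[OF that] by (auto simp: kept_arcs_def)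
  fix v w assume v: "v \<in> verts E - H" and w: "w \<in> verts E - H"
  let ?I = vertex_preideal
  let ?v = "mon [Vertex v]" and ?w = "mon [Vertex w]"
  have vF: "?v \<in> F" and wF: "?w \<in> F" using v w by (auto simp: mon_in_F)
  have "\<exists>g\<in>F. ?v \<star> g \<star> ?w \<notin> ?I"
  proof (rule ccontr)
    assume neg: "\<not> ?thesis"
    \<comment> \<open>Annihilators modulo the ideal, instead of the ideals generated by \<open>w\<close> and \<open>v\<close>: closure under
      multiplication and the inclusion of their product in the ideal are then immediate.\<close>
    define B where "B = {y \<in> F. ?v \<star> y \<in> ?I \<and> (\<forall>g\<in>F. ?v \<star> g \<star> y \<in> ?I)}"
    define A where "A = {x \<in> F. \<forall>y\<in>B. x \<star> y \<in> ?I}"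
    have assoc: "a \<star> b \<star> c = a \<star> (b \<star> c)" if "a \<in> F" "b \<in> F" "c \<in> F" for a b c
      using that by (intro conv_assoc free_carrier_finite)
    have B: "two_sided_ideal (free_algebra K X) B"
      unfolding two_sided_ideal_free_algebra_iff
    proof (intro conjI ballI)
      show "B \<subseteq> F" "0 \<in> B" by (auto simp: B_def two_sided_ideal_zero[OF I(1)])
      fix a assume a: "a \<in> B"
      show "a - b \<in> B" if "b \<in> B" for b
        using a that by (auto simp: B_def conv_diff_right free_carrier_diff intro: two_sided_ideal_diff[OF I(1)])
      fix x assume x: "x \<in> F"
      have aF: "a \<in> F" using a by (simp add: B_def)
      have "?v \<star> g \<star> (x \<star> a) \<in> ?I" if g: "g \<in> F" for g
      proof -
        have "?v \<star> (g \<star> x) \<star> a \<in> ?I" using a g x by (simp add: B_def free_carrier_conv)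
        then show ?thesis using g x aF vF by (simp add: assoc free_carrier_conv)
      qed
      moreover have "?v \<star> (x \<star> a) \<in> ?I"
        using a x aF vF by (auto simp: B_def simp flip: assoc)
      ultimately show "x \<star> a \<in> B" using x aF by (simp add: B_def free_carrier_conv)
      have "?v \<star> g \<star> (a \<star> x) \<in> ?I" if g: "g \<in> F" for g
        using two_sided_ideal_right[OF I(1) _ x, of "?v \<star> g \<star> a"] a g x aF vF
        by (simp add: B_def assoc free_carrier_conv)
      moreover have "?v \<star> (a \<star> x) \<in> ?I"
        using two_sided_ideal_right[OF I(1) _ x, of "?v \<star> a"] a x aF vF by (simp add: B_def assoc)
      ultimately show "a \<star> x \<in> B" using x aF by (simp add: B_def free_carrier_conv)
    qed
    have BF: "B \<subseteq> F" by (auto simp: B_def)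
    have A: "two_sided_ideal (free_algebra K X) A"
      unfolding two_sided_ideal_free_algebra_iff
    proof (intro conjI ballI)
      show "A \<subseteq> F" "0 \<in> A" by (auto simp: A_def two_sided_ideal_zero[OF I(1)])
      fix a assume a: "a \<in> A"
      show "a - b \<in> A" if "b \<in> A" for b
        using a that by (auto simp: A_def conv_diff_left free_carrier_diff intro: two_sided_ideal_diff[OF I(1)])
      fix x assume x: "x \<in> F"
      have aF: "a \<in> F" using a by (simp add: A_def)
      have "x \<star> a \<star> y \<in> ?I" if y: "y \<in> B" for y
        using two_sided_ideal_left[OF I(1) _ x, of "a \<star> y"] a y x aF BF by (auto simp: A_def assoc)
      then show "x \<star> a \<in> A" using x aF by (simp add: A_def free_carrier_conv)
      have "a \<star> x \<star> y \<in> ?I" if y: "y \<in> B" for y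
      proof -
        have "x \<star> y \<in> B" by (rule two_sided_ideal_left[OF B y x])
        then have "a \<star> (x \<star> y) \<in> ?I" using a by (simp add: A_def)
        then show ?thesis using assoc[OF aF x] y BF by auto
      qed
      then show "a \<star> x \<in> A" using x aF by (simp add: A_def free_carrier_conv)
    qed
    have RF: "R \<subseteq> F" by (rule two_sided_ideal_subset[OF R_two_sided])
    have "R \<subseteq> B"
      using I(2) RF vF by (auto simp: B_def intro!: two_sided_ideal_left[OF I(1)] free_carrier_conv)
    moreover have "R \<subseteq> A"
      using I(2) RF BF by (auto simp: A_def intro!: two_sided_ideal_right[OF I(1)])
    ultimately have "A \<subseteq> ?I \<or> B \<subseteq> ?I"
      using P A B by (auto simp: A_def)
    moreover have "?v \<in> A" using vF by (auto simp: A_def B_def)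
    moreover have "?w \<in> B"
    proof -
      have "?v \<star> ?v \<star> ?w \<in> ?I" using neg vF by blast
      moreover have "?v \<star> ?v \<star> ?w - ?v \<star> ?w \<in> R"
        using two_sided_ideal_right[OF R_two_sided relation_in_R[OF leavitt_relations.vertex_idem] wF, of v] v
        by (simp add: conv_diff_left monomial_conv)
      ultimately have "?v \<star> ?w \<in> ?I" using cong_mem[OF I] by blast
      then show ?thesis using wF neg by (auto simp: B_def)
    qed
    ultimately show False using vertex_in_preideal_iff v w by blast
  qed
  then obtain g where g: "g \<in> F" "?v \<star> g \<star> ?w \<notin> ?I" by blast
  have "\<exists>u. g u \<noteq> 0 \<and> mon (Vertex v # u @ [Vertex w]) \<notin> ?I"
  proof (rule ccontr)
    assume neg: "\<not> ?thesis"
    have "?v \<star> g \<star> ?w = ?v \<star> (\<lambda>x. \<Sum>u | g u \<noteq> 0. (g u \<bullet> mon u) x) \<star> ?w"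
      by (rule arg_cong[where f = "\<lambda>z. ?v \<star> z \<star> ?w", OF decompose_monomials[OF free_carrier_finite[OF g(1)]]])
    also have "\<dots> = (\<lambda>x. \<Sum>u | g u \<noteq> 0. (g u \<bullet> mon (Vertex v # u @ [Vertex w])) x)"
      by (simp only: conv_sum_left conv_sum_right monomial_conv append.simps flip: scale_conv conv_scale)
    also have "\<dots> \<in> ?I"
      using neg by (intro two_sided_ideal_sum[OF I(1)] vertex_preideal_scale) auto
    finally show False using g(2) by simp
  qed
  then obtain u where u: "g u \<noteq> 0" "mon (Vertex v # u @ [Vertex w]) \<notin> ?I" by blast
  moreover have "set u \<subseteq> X" using g(1) u(1) by (auto simp: free_carrier_def)
  ultimately show "\<exists>y\<in>verts E - H. connects E v y \<and> connects E w y"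
    using common_successor v w by blast
qed

end

theorem proposition5p6:
  fixes E :: "('v, 'e) pre_digraph" and H :: "'v set"
  assumes "row_finite_graph E"
    and "H \<subseteq> verts E" and "hereditary E H" and "saturated E H"
  shows "prime_ideal (leavitt_path_algebra TYPE('k::field) E) (vertex_ideal TYPE('k) E H)
    \<longleftrightarrow> maximal_tail E (verts E - H)"
proof -
  interpret leavitt E "TYPE('k)" H
    using assms by (simp add: leavitt_def leavitt_axioms_def)
  show ?thesis using prime_if_maximal_tail maximal_tail_if_prime by blast
qed

end
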